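(* Let $k$ be a field of characteristic $3$, let $\mathcal A$ be a commutative associative $k$-algebra and let $\mathcal D\subset\mathrm{Der}(\mathcal A)$ be a restricted Lie subalgebra (closed under commutator and under $f\mapsto f\circ f\circ f$). Then the space $\mathcal A\otimes\mathcal D$, with the bracket and $3$-map given by $$[a\otimes f,b\otimes g]=ab\otimes[f,g],\qquad(a\otimes f)^{[3]}=a^3\otimes f^3,$$ and the product $$(a\otimes f)\blacktriangleright(b\otimes g):=af(b)\otimes g,\qquad a,b\in\mathcal A,\ f,g\in\mathcal D,$$ is a trivially restricted post-Lie algebra.
   Context: $\mathrm{Der}(\mathcal A)$ is the space of derivations of $\mathcal A$, a restricted Lie algebra with commutator bracket and $p$-map $f\mapsto f^p$ (composition power). The $3$-map on $\mathcal A\otimes\mathcal D$ is the one given by the displayed formula on elementary tensors and extended to all elements by the Jacobson identities for $p$-maps. A post-Lie algebra is a Lie algebra $(\mathfrak g,[-,-])$ with a bilinear operation $\blacktriangleright$ such that for all $x,y,z$: $x\blacktriangleright[y,z]=[x\blacktriangleright y,z]+[y,x\blacktriangleright z]$ and $[x,y]\blacktriangleright z=a_\blacktriangleright(x,y,z)-a_\blacktriangleright(y,x,z)$, with $a_\blacktriangleright(x,y,z)=x\blacktriangleright(y\blacktriangleright z)-(x\blacktriangleright y)\blacktriangleright z$. In characteristic $3$, a trivially restricted post-Lie algebra is a tuple $(\mathfrak g,[-,-],(-)^{[3]},\blacktriangleright)$ such that $(\mathfrak g,[-,-],(-)^{[3]})$ is a restricted Lie algebra, $(\mathfrak g,[-,-],\blacktriangleright)$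 is a post-Lie algebra, and for all $x,y\in\mathfrak g$: $$x\blacktriangleright y^{[3]}=\mathrm{ad}_y^2(x\blacktriangleright y),$$ $$x^{[3]}\blacktriangleright y=x\blacktriangleright(x\blacktriangleright(x\blacktriangleright y))+2(x\blacktriangleright x)\blacktriangleright(x\blacktriangleright y)+x\blacktriangleright((x\blacktriangleright x)\blacktriangleright y)+((x\blacktriangleright x)\blacktriangleright x)\blacktriangleright y+(x\blacktriangleright(x\blacktriangleright x))\blacktriangleright y.$$ *)

theory Defs
  imports "HOL-Algebra.Module" "HOL-Algebra.Multiplicative_Group" "HOL-Algebra.Free_Abelian_Groups"
begin

section \<open>Characteristic, bilinear operations, commutative algebras\<close>

text \<open>The additive order of the unit, which is \<open>0\<close> if that order is infinite.\<close>

definition ring_char :: "('k, 'm) ring_scheme \<Rightarrow> nat" where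
  "ring_char K = group.ord (add_monoid K) \<one>\<^bsub>K\<^esub>"

definition bilinear_op ::
  "('k, 'm) ring_scheme \<Rightarrow> ('k, 'v, 'n) module_scheme \<Rightarrow> ('v \<Rightarrow> 'v \<Rightarrow> 'v) \<Rightarrow> bool" where
  "bilinear_op K V b \<longleftrightarrow>
     (\<forall>x\<in>carrier V. \<forall>y\<in>carrier V. b x y \<in> carrier V) \<and>
     (\<forall>x\<in>carrier V. \<forall>y\<in>carrier V. \<forall>z\<in>carrier V.
        b (x \<oplus>\<^bsub>V\<^esub> y) z = b x z \<oplus>\<^bsub>V\<^esub> b y z \<and> b x (y \<oplus>\<^bsub>V\<^esub> z) = b x y \<oplus>\<^bsub>V\<^esub> b x z) \<and>
     (\<forall>c\<in>carrier K. \<forall>x\<in>carrier V. \<forall>y\<in>carrier V.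
        b (c \<odot>\<^bsub>V\<^esub> x) y = c \<odot>\<^bsub>V\<^esub> b x y \<and> b x (c \<odot>\<^bsub>V\<^esub> y) = c \<odot>\<^bsub>V\<^esub> b x y)"

text \<open>No unit is required: the field \<open>one\<close> of the record \<open>A\<close> is ignored, so powers in \<open>A\<close> are
  written out as products. The unital case is the library locale \<^locale>\<open>algebra\<close>.\<close>

locale comm_assoc_algebra = module K A for K (structure) and A (structure) +
  assumes mult_bilinear: "bilinear_op K A (\<otimes>\<^bsub>A\<^esub>)"
    and mult_assoc: "\<lbrakk>x \<in> carrier A; y \<in> carrier A; z \<in> carrier A\<rbrakk>
      \<Longrightarrow> (x \<otimes>\<^bsub>A\<^esub> y) \<otimes>\<^bsub>A\<^esub> z = x \<otimes>\<^bsub>A\<^esub> (y \<otimes>\<^bsub>A\<^esub> z)"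
    and mult_comm: "\<lbrakk>x \<in> carrier A; y \<in> carrier A\<rbrakk> \<Longrightarrow> x \<otimes>\<^bsub>A\<^esub> y = y \<otimes>\<^bsub>A\<^esub> x"

lemma algebra_imp_comm_assoc_algebra:
  assumes "algebra K A"
  shows "comm_assoc_algebra K A"
proof -
  have "cring A" and "module K A" using assms by (simp_all add: algebra_def)
  interpret cring A by fact
  note l = algebra.smult_assoc2 [OF assms]
  have r: "x \<otimes>\<^bsub>A\<^esub> (c \<odot>\<^bsub>A\<^esub> y) = c \<odot>\<^bsub>A\<^esub> (x \<otimes>\<^bsub>A\<^esub> y)"
    if "c \<in> carrier K" "x \<in> carrier A" "y \<in> carrier A" for c x y
    using that by (metis m_comm l module.smult_closed [OF \<open>module K A\<close>])
  show ?thesis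
    by (intro comm_assoc_algebra.intro comm_assoc_algebra_axioms.intro \<open>module K A\<close>)
      (auto simp: bilinear_op_def l_distr r_distr l r m_assoc, simp add: m_comm)
qed

section \<open>Lie, restricted Lie and post-Lie algebras\<close>

locale lie_algebra = module K L
  for K :: "('k, 'm) ring_scheme" (structure) and L :: "('k, 'v, 'n) module_scheme" (structure) +
  fixes br :: "'v \<Rightarrow> 'v \<Rightarrow> 'v"
  assumes br_bilinear: "bilinear_op K L br"
    and br_alternating: "x \<in> carrier L \<Longrightarrow> br x x = \<zero>\<^bsub>L\<^esub>"
    and br_jacobi: "\<lbrakk>x \<in> carrier L; y \<in> carrier L; z \<in> carrier L\<rbrakk>
      \<Longrightarrow> br x (br y z) \<oplus>\<^bsub>L\<^esub> br y (br z x) \<oplus>\<^bsub>L\<^esub> br z (br x y) = \<zero>\<^bsub>L\<^esub>"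

text \<open>Jacobson's formula for \<open>p = 3\<close>. In general \<open>(x + y)^[p]\<close> is \<open>x^[p] + y^[p]\<close> plus the sum of
  \<open>s_1, ..., s_(p-1)\<close>, where \<open>i * s_i\<close> is the coefficient of \<open>t^(i-1)\<close> in \<open>ad(t x + y)^(p-1) (x)\<close>.
  For \<open>p = 3\<close> the latter is \<open>t [x,[y,x]] + [y,[y,x]]\<close>, so \<open>s_1 = [y,[y,x]]\<close> and, as \<open>1/2 = -1\<close>,
  \<open>s_2 = [x,[x,y]]\<close>.\<close>

definition jacobson3 ::
  "('k, 'v, 'n) module_scheme \<Rightarrow> ('v \<Rightarrow> 'v \<Rightarrow> 'v) \<Rightarrow> ('v \<Rightarrow> 'v) \<Rightarrow> bool" where
  "jacobson3 L br pm \<longleftrightarrow>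
     (\<forall>x\<in>carrier L. \<forall>y\<in>carrier L.
        pm (x \<oplus>\<^bsub>L\<^esub> y) = pm x \<oplus>\<^bsub>L\<^esub> pm y \<oplus>\<^bsub>L\<^esub> br x (br x y) \<oplus>\<^bsub>L\<^esub> br y (br y x))"

locale restricted_lie_algebra3 = lie_algebra K L br
  for K :: "('k, 'm) ring_scheme" (structure) and L :: "('k, 'v, 'n) module_scheme" (structure) and br +
  fixes pm :: "'v \<Rightarrow> 'v"
  assumes char3: "ring_char K = 3"
    and pm_closed: "x \<in> carrier L \<Longrightarrow> pm x \<in> carrier L"
    and pm_smult: "\<lbrakk>c \<in> carrier K; x \<in> carrier L\<rbrakk>
      \<Longrightarrow> pm (c \<odot>\<^bsub>L\<^esub> x) = (c [^]\<^bsub>K\<^esub> (3::nat)) \<odot>\<^bsub>L\<^esub> pm x"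
    and pm_ad: "\<lbrakk>x \<in> carrier L; y \<in> carrier L\<rbrakk> \<Longrightarrow> br (pm x) y = br x (br x (br x y))"
    and pm_jacobson: "jacobson3 L br pm"

definition associator ::
  "('k, 'v, 'n) module_scheme \<Rightarrow> ('v \<Rightarrow> 'v \<Rightarrow> 'v) \<Rightarrow> 'v \<Rightarrow> 'v \<Rightarrow> 'v \<Rightarrow> 'v" where
  "associator V pr x y z = pr x (pr y z) \<ominus>\<^bsub>V\<^esub> pr (pr x y) z"

locale post_lie_algebra = lie_algebra K L br
  for K :: "('k, 'm) ring_scheme" (structure) and L :: "('k, 'v, 'n) module_scheme" (structure) and br +
  fixes pr :: "'v \<Rightarrow> 'v \<Rightarrow> 'v"
  assumes pr_bilinear: "bilinear_op K L pr"
    and pr_br: "\<lbrakk>x \<in> carrier L; y \<in> carrier L; z \<in> carrier L\<rbrakk>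
      \<Longrightarrow> pr x (br y z) = br (pr x y) z \<oplus>\<^bsub>L\<^esub> br y (pr x z)"
    and br_pr: "\<lbrakk>x \<in> carrier L; y \<in> carrier L; z \<in> carrier L\<rbrakk>
      \<Longrightarrow> pr (br x y) z = associator L pr x y z \<ominus>\<^bsub>L\<^esub> associator L pr y x z"

locale trivially_restricted_post_lie_algebra3 =
  restricted_lie_algebra3 K L br pm + post_lie_algebra K L br pr
  for K :: "('k, 'm) ring_scheme" (structure) and L :: "('k, 'v, 'n) module_scheme" (structure) and br and pm and pr +
  assumes pr_pm: "\<lbrakk>x \<in> carrier L; y \<in> carrier L\<rbrakk> \<Longrightarrow> pr x (pm y) = br y (br y (pr x y))"
    and pm_pr: "\<lbrakk>x \<in> carrier L; y \<in> carrier L\<rbrakk> \<Longrightarrow>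
      pr (pm x) y =
        pr x (pr x (pr x y)) \<oplus>\<^bsub>L\<^esub> add_pow L (2::nat) (pr (pr x x) (pr x y))
        \<oplus>\<^bsub>L\<^esub> pr x (pr (pr x x) y) \<oplus>\<^bsub>L\<^esub> pr (pr (pr x x) x) y \<oplus>\<^bsub>L\<^esub> pr (pr x (pr x x)) y"

section \<open>Derivations\<close>

text \<open>Linear maps are represented by functions that are \<open>undefined\<close> outside the carrier, so that
  equality of maps is equality of functions.\<close>

definition endo_algebra ::
  "('k, 'm) ring_scheme \<Rightarrow> ('k, 'a, 'n) module_scheme \<Rightarrow> ('k, 'a \<Rightarrow> 'a) module" where
  "endo_algebra K A =
    \<lparr>carrier = {f \<in> carrier A \<rightarrow>\<^sub>E carrier A.
        (\<forall>x\<in>carrier A. \<forall>y\<in>carrier A. f (x \<oplus>\<^bsub>A\<^esub> y) = f x \<oplus>\<^bsub>A\<^esub> f y) \<and>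
        (\<forall>c\<in>carrier K. \<forall>x\<in>carrier A. f (c \<odot>\<^bsub>A\<^esub> x) = c \<odot>\<^bsub>A\<^esub> f x)},
     monoid.mult = compose (carrier A),
     monoid.one = (\<lambda>x\<in>carrier A. x),
     ring.zero = (\<lambda>x\<in>carrier A. \<zero>\<^bsub>A\<^esub>),
     ring.add = (\<lambda>f g. \<lambda>x\<in>carrier A. f x \<oplus>\<^bsub>A\<^esub> g x),
     module.smult = (\<lambda>c f. \<lambda>x\<in>carrier A. c \<odot>\<^bsub>A\<^esub> f x)\<rparr>"

definition derivations ::
  "('k, 'm) ring_scheme \<Rightarrow> ('k, 'a, 'n) module_scheme \<Rightarrow> ('a \<Rightarrow> 'a) set" where
  "derivations K A = {f \<in> carrier (endo_algebra K A).
     \<forall>x\<in>carrier A. \<forall>y\<in>carrier A. f (x \<otimes>\<^bsub>A\<^esub> y) = f x \<otimes>\<^bsub>A\<^esub> y \<oplus>\<^bsub>A\<^esub> x \<otimes>\<^bsub>A\<^esub> f y}"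

definition commutator :: "('b, 'n) ring_scheme \<Rightarrow> 'b \<Rightarrow> 'b \<Rightarrow> 'b" where
  "commutator E f g = f \<otimes>\<^bsub>E\<^esub> g \<ominus>\<^bsub>E\<^esub> g \<otimes>\<^bsub>E\<^esub> f"

definition restricted_lie_subalgebra3 ::
  "('a \<Rightarrow> 'a) set \<Rightarrow> ('k, 'm) ring_scheme \<Rightarrow> ('k, 'a, 'n) module_scheme \<Rightarrow> bool" where
  "restricted_lie_subalgebra3 D K A \<longleftrightarrow>
     D \<subseteq> derivations K A \<and>
     submodule D K (endo_algebra K A) \<and>
     (\<forall>f\<in>D. \<forall>g\<in>D. commutator (endo_algebra K A) f g \<in> D) \<and>
     (\<forall>f\<in>D. f [^]\<^bsub>endo_algebra K A\<^esub> (3::nat) \<in> D)"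

section \<open>Tensor products\<close>

text \<open>\<open>M \<otimes> N\<close> over \<open>K\<close> is the free abelian group on \<open>M \<times> N\<close> modulo the subgroup that makes
  \<open>(x, y) \<mapsto> x \<otimes> y\<close> biadditive and balanced; its elements are cosets.\<close>

definition tensor_free ::
  "('k, 'a, 'm) module_scheme \<Rightarrow> ('k, 'b, 'n) module_scheme \<Rightarrow> (('a \<times> 'b) \<Rightarrow>\<^sub>0 int) monoid" where
  "tensor_free M N = free_Abelian_group (carrier M \<times> carrier N)"

definition tensor_rel ::
  "('k, 'r) ring_scheme \<Rightarrow> ('k, 'a, 'm) module_scheme \<Rightarrow> ('k, 'b, 'n) module_scheme
    \<Rightarrow> (('a \<times> 'b) \<Rightarrow>\<^sub>0 int) set" where
  "tensor_rel K M N = generate (tensor_free M N)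
     ({frag_of (x \<oplus>\<^bsub>M\<^esub> x', y) - frag_of (x, y) - frag_of (x', y) | x x' y.
         x \<in> carrier M \<and> x' \<in> carrier M \<and> y \<in> carrier N} \<union>
      {frag_of (x, y \<oplus>\<^bsub>N\<^esub> y') - frag_of (x, y) - frag_of (x, y') | x y y'.
         x \<in> carrier M \<and> y \<in> carrier N \<and> y' \<in> carrier N} \<union>
      {frag_of (c \<odot>\<^bsub>M\<^esub> x, y) - frag_of (x, c \<odot>\<^bsub>N\<^esub> y) | c x y.
         c \<in> carrier K \<and> x \<in> carrier M \<and> y \<in> carrier N})"

text \<open>Scalars act by \<open>c (x \<otimes> y) = (c x) \<otimes> y\<close>: the image of a coset \<open>U\<close> under the induced map of
  the free group lies in a single coset, which is recovered by adding the subgroup of relations.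
  The fields \<open>mult\<close> and \<open>one\<close> play no role in a module.\<close>

definition tensor ::
  "('k, 'r) ring_scheme \<Rightarrow> ('k, 'a, 'm) module_scheme \<Rightarrow> ('k, 'b, 'n) module_scheme
    \<Rightarrow> ('k, (('a \<times> 'b) \<Rightarrow>\<^sub>0 int) set) module" where
  "tensor K M N =
    \<lparr>carrier = carrier (tensor_free M N Mod tensor_rel K M N),
     monoid.mult = undefined,
     monoid.one = undefined,
     ring.zero = \<one>\<^bsub>tensor_free M N Mod tensor_rel K M N\<^esub>,
     ring.add = (\<otimes>\<^bsub>tensor_free M N Mod tensor_rel K M N\<^esub>),
     module.smult = (\<lambda>c U. tensor_rel K M N <#>\<^bsub>tensor_free M N\<^esub>
        frag_extend (\<lambda>(x, y). frag_of (c \<odot>\<^bsub>M\<^esub> x, y)) ` U)\<rparr>"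

definition pure_tensor ::
  "('k, 'r) ring_scheme \<Rightarrow> ('k, 'a, 'm) module_scheme \<Rightarrow> ('k, 'b, 'n) module_scheme
    \<Rightarrow> 'a \<Rightarrow> 'b \<Rightarrow> (('a \<times> 'b) \<Rightarrow>\<^sub>0 int) set" where
  "pure_tensor K M N x y = tensor_rel K M N #>\<^bsub>tensor_free M N\<^esub> frag_of (x, y)"

section \<open>The operations on \<open>A \<otimes> D\<close>\<close>

definition sub_endo ::
  "('k, 'm) ring_scheme \<Rightarrow> ('k, 'a, 'n) module_scheme \<Rightarrow> ('a \<Rightarrow> 'a) set
    \<Rightarrow> ('k, 'a \<Rightarrow> 'a) module" where
  "sub_endo K A D = (endo_algebra K A)\<lparr>carrier := D\<rparr>"

text \<open>The bracket and the product are the bilinear extensions of their values on elementary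
  tensors, the 3-map is the extension by Jacobson's formula. Restricting to functions that are
  \<open>undefined\<close> outside the carrier makes it meaningful to say that these extensions are unique.\<close>

definition tensor_operations ::
  "('k, 'm) ring_scheme \<Rightarrow> ('k, 'a, 'n) module_scheme \<Rightarrow> ('a \<Rightarrow> 'a) set
    \<Rightarrow> ((('a \<times> ('a \<Rightarrow> 'a)) \<Rightarrow>\<^sub>0 int) set \<Rightarrow> (('a \<times> ('a \<Rightarrow> 'a)) \<Rightarrow>\<^sub>0 int) set
         \<Rightarrow> (('a \<times> ('a \<Rightarrow> 'a)) \<Rightarrow>\<^sub>0 int) set)
    \<Rightarrow> ((('a \<times> ('a \<Rightarrow> 'a)) \<Rightarrow>\<^sub>0 int) set \<Rightarrow> (('a \<times> ('a \<Rightarrow> 'a)) \<Rightarrow>\<^sub>0 int) set)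
    \<Rightarrow> ((('a \<times> ('a \<Rightarrow> 'a)) \<Rightarrow>\<^sub>0 int) set \<Rightarrow> (('a \<times> ('a \<Rightarrow> 'a)) \<Rightarrow>\<^sub>0 int) set
         \<Rightarrow> (('a \<times> ('a \<Rightarrow> 'a)) \<Rightarrow>\<^sub>0 int) set)
    \<Rightarrow> bool" where
  "tensor_operations K A D br pm pr \<longleftrightarrow>
    (let E = endo_algebra K A;
         T = tensor K A (sub_endo K A D);
         t = pure_tensor K A (sub_endo K A D)
     in
       br \<in> carrier T \<rightarrow>\<^sub>E carrier T \<rightarrow>\<^sub>E carrier T \<and>
       pm \<in> carrier T \<rightarrow>\<^sub>E carrier T \<and>
       pr \<in> carrier T \<rightarrow>\<^sub>E carrier T \<rightarrow>\<^sub>E carrier T \<and>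
       bilinear_op K T br \<and>
       jacobson3 T br pm \<and>
       bilinear_op K T pr \<and>
       (\<forall>a\<in>carrier A. \<forall>b\<in>carrier A. \<forall>f\<in>D. \<forall>g\<in>D.
          br (t a f) (t b g) = t (a \<otimes>\<^bsub>A\<^esub> b) (commutator E f g) \<and>
          pr (t a f) (t b g) = t (a \<otimes>\<^bsub>A\<^esub> f b) g) \<and>
       (\<forall>a\<in>carrier A. \<forall>f\<in>D.
          pm (t a f) = t (a \<otimes>\<^bsub>A\<^esub> a \<otimes>\<^bsub>A\<^esub> a) (f [^]\<^bsub>E\<^esub> (3::nat))))"

end

theory Submission
  imports Defs
begin

text \<open>All identities other than the existence of the 3-map are verified on elementary tensors and
  extended by (multi)linearity; for the identities that involve the 3-map, the correction terms of
  Jacobson's formula are absorbed by identities that hold in every Lie or post-Lie algebra of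
  characteristic 3.

  The 3-map exists because Jacobson's correction term \<open>[x,[x,y]] + [y,[y,x]]\<close> is a symmetric
  2-cocycle in characteristic 3. It therefore twists the addition on \<open>T \<times> T\<close>, for the tensor product
  \<open>T\<close>, to another abelian group, and \<open>(a, f) \<mapsto> (a \<otimes> f, a\<^sup>3 \<otimes> f\<^sup>3)\<close> is biadditive and balanced
  with values in that group. By the universal property it extends to \<open>T\<close>, and the second component
  of the extension is the 3-map. No basis of \<open>T\<close> is needed.\<close>

section \<open>The universal property of the tensor product\<close>

locale module_pair = M: module K M + N: module K N
  for K :: "('k, 'r) ring_scheme" (structure)
    and M :: "('k, 'a, 'm) module_scheme"
    and N :: "('k, 'b, 'n) module_scheme"
begin

abbreviation "F \<equiv> tensor_free M N"
abbreviation "R \<equiv> tensor_rel K M N"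
abbreviation "T \<equiv> tensor K M N"
abbreviation "t \<equiv> pure_tensor K M N"

sublocale F: comm_group F
  by (simp add: tensor_free_def abelian_free_Abelian_group)

lemma F_simps [simp]:
  "u \<in> carrier F \<longleftrightarrow> Poly_Mapping.keys u \<subseteq> carrier M \<times> carrier N"
  "u \<otimes>\<^bsub>F\<^esub> v = u + v" "\<one>\<^bsub>F\<^esub> = 0"
  by (simp_all add: tensor_free_def)

section \<open>The subgroup of relations\<close>

lemma subgroup_tensor_rel: "subgroup R F"
  unfolding tensor_rel_def
  by (rule F.generate_is_subgroup) (auto dest!: subsetD [OF keys_diff])

sublocale R: normal R F
  by (rule F.subgroup_imp_normal [OF subgroup_tensor_rel])

lemma relation_add_left:
  "\<lbrakk>x \<in> carrier M; x' \<in> carrier M; y \<in> carrier N\<rbrakk>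
    \<Longrightarrow> frag_of (x \<oplus>\<^bsub>M\<^esub> x', y) - frag_of (x, y) - frag_of (x', y) \<in> R"
  unfolding tensor_rel_def by (rule generate.incl) blast

lemma relation_add_right:
  "\<lbrakk>x \<in> carrier M; y \<in> carrier N; y' \<in> carrier N\<rbrakk>
    \<Longrightarrow> frag_of (x, y \<oplus>\<^bsub>N\<^esub> y') - frag_of (x, y) - frag_of (x, y') \<in> R"
  unfolding tensor_rel_def by (rule generate.incl) blast

lemma relation_smult:
  "\<lbrakk>c \<in> carrier K; x \<in> carrier M; y \<in> carrier N\<rbrakk>
    \<Longrightarrow> frag_of (c \<odot>\<^bsub>M\<^esub> x, y) - frag_of (x, c \<odot>\<^bsub>N\<^esub> y) \<in> R"
  unfolding tensor_rel_def by (rule generate.incl) blast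

text \<open>The kernel of a homomorphism is a subgroup, so it contains \<open>R\<close> as soon as
  it contains the three families of generators. This is applied to maps out of the tensor product
  and to the scaling map.\<close>

lemma tensor_rel_subset_kernel:
  assumes "group G" and h: "h \<in> hom F G"
    and "\<And>x x' y. \<lbrakk>x \<in> carrier M; x' \<in> carrier M; y \<in> carrier N\<rbrakk>
      \<Longrightarrow> h (frag_of (x \<oplus>\<^bsub>M\<^esub> x', y)) = h (frag_of (x, y)) \<otimes>\<^bsub>G\<^esub> h (frag_of (x', y))"
    and "\<And>x y y'. \<lbrakk>x \<in> carrier M; y \<in> carrier N; y' \<in> carrier N\<rbrakk>
      \<Longrightarrow> h (frag_of (x, y \<oplus>\<^bsub>N\<^esub> y')) = h (frag_of (x, y)) \<otimes>\<^bsub>G\<^esub> h (frag_of (x, y'))"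
    and "\<And>c x y. \<lbrakk>c \<in> carrier K; x \<in> carrier M; y \<in> carrier N\<rbrakk>
      \<Longrightarrow> h (frag_of (c \<odot>\<^bsub>M\<^esub> x, y)) = h (frag_of (x, c \<odot>\<^bsub>N\<^esub> y))"
  shows "R \<subseteq> kernel F G h"
proof -
  interpret h: group_hom F G h
    using assms(1,2) by (simp add: group_hom_def group_hom_axioms_def F.is_group)
  have sum: "h (u + v) = h u \<otimes>\<^bsub>G\<^esub> h v" if "u \<in> carrier F" "v \<in> carrier F" for u v
    using h.hom_mult [OF that] by simp
  have ker: "u - v - w \<in> kernel F G h"
    if "u \<in> carrier F" "v \<in> carrier F" "w \<in> carrier F" "h u = h v \<otimes>\<^bsub>G\<^esub> h w" for u v w
  proof -
    have c: "u - v - w \<in> carrier F"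
      using that by (auto dest!: subsetD [OF keys_diff])
    have vw: "v + w \<in> carrier F" using F.m_closed [OF that(2,3)] by simp
    \<comment> \<open>Adding \<open>v + w\<close> back gives \<open>u\<close>, and cancelling
      \<open>h u\<close> in \<open>G\<close> leaves the unit; \<open>h\<close> is never computed on
      a difference directly.\<close>
    have "h ((u - v - w) + (v + w)) = h (u - v - w) \<otimes>\<^bsub>G\<^esub> h (v + w)"
      by (rule sum [OF c vw])
    moreover have "(u - v - w) + (v + w) = u" by simp
    moreover have "h (v + w) = h u"
      using sum [OF that(2,3)] that(4) by (simp only:)
    ultimately have "h u = h (u - v - w) \<otimes>\<^bsub>G\<^esub> h u"
      by (simp only:)
    moreover have "h u \<in> carrier G" "h (u - v - w) \<in> carrier G"
      by (rule h.hom_closed [OF that(1)], rule h.hom_closed [OF c])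
    ultimately have "h (u - v - w) = \<one>\<^bsub>G\<^esub>"
      by (metis h.H.r_cancel_one)
    with c show ?thesis by (simp add: kernel_def)
  qed
  have of: "frag_of (x, y) \<in> carrier F" if "x \<in> carrier M" "y \<in> carrier N" for x y
    using that by simp
  \<comment> \<open>The two-term relation is the case \<open>w = 0\<close> of the three-term
    one.\<close>
  have z: "u - v \<in> kernel F G h" if "u \<in> carrier F" "v \<in> carrier F" "h u = h v" for u v
    using ker [of u v 0] that h.hom_one h.hom_closed [OF that(1)] by simp
  show ?thesis
    unfolding tensor_rel_def
    by (rule F.generate_subgroup_incl [OF _ h.subgroup_kernel],
        intro Un_least; clarify; (rule ker | rule z))
      (simp_all only: of assms M.a_closed N.a_closed M.smult_closed N.smult_closed)
qed

section \<open>The quotient group and its elementary tensors\<close>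

sublocale Q: comm_group "F Mod R"
  by (rule F.abelian_FactGroup [OF subgroup_tensor_rel])

lemma tensor_sel:
  "carrier T = carrier (F Mod R)" "(\<oplus>\<^bsub>T\<^esub>) = (\<otimes>\<^bsub>F Mod R\<^esub>)" "\<zero>\<^bsub>T\<^esub> = \<one>\<^bsub>F Mod R\<^esub>"
  by (simp_all add: tensor_def)

lemma hom_add_monoid_tensor: "hom (add_monoid T) G = hom (F Mod R) G"
  by (simp add: hom_def tensor_sel)

sublocale T: abelian_group T
proof (rule abelian_groupI)
  show "\<exists>v\<in>carrier T. v \<oplus>\<^bsub>T\<^esub> u = \<zero>\<^bsub>T\<^esub>" if "u \<in> carrier T" for u
    using that Q.l_inv_ex unfolding tensor_sel by blast
qed (unfold tensor_sel, simp_all add: Q.m_ac del: mult_FactGroup one_FactGroup)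

lemma carrier_tensor: "carrier T = (\<lambda>u. R #>\<^bsub>F\<^esub> u) ` carrier F"
  by (simp add: tensor_def carrier_FactGroup)

lemma coset_add:
  "\<lbrakk>u \<in> carrier F; v \<in> carrier F\<rbrakk>
    \<Longrightarrow> (R #>\<^bsub>F\<^esub> u) \<oplus>\<^bsub>T\<^esub> (R #>\<^bsub>F\<^esub> v) = R #>\<^bsub>F\<^esub> (u + v)"
  using R.rcos_sum [of u v] by (simp add: tensor_def)

lemma coset_eqI:
  assumes "u \<in> carrier F" "v \<in> carrier F" "u - v \<in> R"
  shows "R #>\<^bsub>F\<^esub> u = R #>\<^bsub>F\<^esub> v"
proof -
  have "u = (u - v) \<otimes>\<^bsub>F\<^esub> v" by simp
  then have "u \<in> R #>\<^bsub>F\<^esub> v"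
    using assms(3) by (metis F.rcosI R.subset assms(2))
  then show ?thesis by (metis F.repr_independence assms(2) subgroup_tensor_rel)
qed

lemma pure_closed [simp, intro]: "\<lbrakk>x \<in> carrier M; y \<in> carrier N\<rbrakk> \<Longrightarrow> t x y \<in> carrier T"
  by (auto simp: carrier_tensor pure_tensor_def)

lemma pure_add_left:
  assumes "x \<in> carrier M" "x' \<in> carrier M" "y \<in> carrier N"
  shows "t (x \<oplus>\<^bsub>M\<^esub> x') y = t x y \<oplus>\<^bsub>T\<^esub> t x' y"
proof -
  have k: "Poly_Mapping.keys (frag_of (x, y) + frag_of (x', y)) \<subseteq> carrier M \<times> carrier N"
    using assms F.m_closed [of "frag_of (x, y)" "frag_of (x', y)"] by simp
  show ?thesis
    using assms k relation_add_left [OF assms]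
    by (simp add: pure_tensor_def coset_add) (intro coset_eqI, auto simp: algebra_simps)
qed

lemma pure_add_right:
  assumes "x \<in> carrier M" "y \<in> carrier N" "y' \<in> carrier N"
  shows "t x (y \<oplus>\<^bsub>N\<^esub> y') = t x y \<oplus>\<^bsub>T\<^esub> t x y'"
proof -
  have k: "Poly_Mapping.keys (frag_of (x, y) + frag_of (x, y')) \<subseteq> carrier M \<times> carrier N"
    using assms F.m_closed [of "frag_of (x, y)" "frag_of (x, y')"] by simp
  show ?thesis
    using assms k relation_add_right [OF assms]
    by (simp add: pure_tensor_def coset_add) (intro coset_eqI, auto simp: algebra_simps)
qed

lemma pure_smult:
  "\<lbrakk>c \<in> carrier K; x \<in> carrier M; y \<in> carrier N\<rbrakk> \<Longrightarrow> t (c \<odot>\<^bsub>M\<^esub> x) y = t x (c \<odot>\<^bsub>N\<^esub> y)"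
  unfolding pure_tensor_def by (intro coset_eqI) (simp_all add: relation_smult)

lemma pure_zero_left [simp]: "y \<in> carrier N \<Longrightarrow> t \<zero>\<^bsub>M\<^esub> y = \<zero>\<^bsub>T\<^esub>"
  using pure_add_left [of "\<zero>\<^bsub>M\<^esub>" "\<zero>\<^bsub>M\<^esub>" y] by (simp add: T.add.r_cancel_one')

lemma pure_zero_right [simp]: "x \<in> carrier M \<Longrightarrow> t x \<zero>\<^bsub>N\<^esub> = \<zero>\<^bsub>T\<^esub>"
  using pure_add_right [of x "\<zero>\<^bsub>N\<^esub>" "\<zero>\<^bsub>N\<^esub>"] by (simp add: T.add.r_cancel_one')

lemma pure_minus_left:
  assumes "x \<in> carrier M" "y \<in> carrier N" shows "t (\<ominus>\<^bsub>M\<^esub> x) y = \<ominus>\<^bsub>T\<^esub> t x y"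
proof -
  have "t (\<ominus>\<^bsub>M\<^esub> x) y \<oplus>\<^bsub>T\<^esub> t x y = \<zero>\<^bsub>T\<^esub>"
    using assms pure_add_left [of "\<ominus>\<^bsub>M\<^esub> x" x y] by (simp add: M.l_neg)
  then show ?thesis using assms by (simp add: T.minus_equality)
qed

text \<open>Elementary tensors generate the quotient already under sums, since
  \<open>- (x \<otimes> y) = (- x) \<otimes> y\<close> and \<open>0 = 0 \<otimes> 0\<close>. Hence
  closure under addition is the only inductive case.\<close>

lemma tensor_induct [consumes 1, case_names pure add]:
  assumes "z \<in> carrier T"
    and pure: "\<And>x y. \<lbrakk>x \<in> carrier M; y \<in> carrier N\<rbrakk> \<Longrightarrow> P (t x y)"
    and add: "\<And>u v. \<lbrakk>u \<in> carrier T; v \<in> carrier T; P u; P v\<rbrakk> \<Longrightarrow> P (u \<oplus>\<^bsub>T\<^esub> v)"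
  shows "P z"
proof -
  obtain u where u: "Poly_Mapping.keys u \<subseteq> carrier M \<times> carrier N" and z: "z = R #>\<^bsub>F\<^esub> u"
    using assms(1) by (auto simp: carrier_tensor)
  \<comment> \<open>Induction over the free abelian group passes through differences, so the claim
    is carried along for \<open>- u\<close> as well.\<close>
  have "P (R #>\<^bsub>F\<^esub> u) \<and> P (R #>\<^bsub>F\<^esub> (- u))"
    using u
  proof (induction u rule: free_Abelian_group_induct [consumes 1, case_names zero diff of])
    case zero
    have "R #>\<^bsub>F\<^esub> 0 = t \<zero>\<^bsub>M\<^esub> \<zero>\<^bsub>N\<^esub>"
      using F.coset_join2 [of 0] R.one_closed subgroup_tensor_rel
      by (simp add: tensor_def)
    then show ?case using pure [of "\<zero>\<^bsub>M\<^esub>" "\<zero>\<^bsub>N\<^esub>"] by simp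
  next
    case (diff u v)
    then have "u \<in> carrier F" "v \<in> carrier F" "- u \<in> carrier F" "- v \<in> carrier F"
      by simp_all
    note * = this
    have "P ((R #>\<^bsub>F\<^esub> u) \<oplus>\<^bsub>T\<^esub> (R #>\<^bsub>F\<^esub> (- v)))" "P ((R #>\<^bsub>F\<^esub> v) \<oplus>\<^bsub>T\<^esub> (R #>\<^bsub>F\<^esub> (- u)))"
      using diff * by (intro add; auto simp: carrier_tensor simp del: F_simps)+
    moreover have "(R #>\<^bsub>F\<^esub> u) \<oplus>\<^bsub>T\<^esub> (R #>\<^bsub>F\<^esub> (- v)) = R #>\<^bsub>F\<^esub> (u - v)"
      "(R #>\<^bsub>F\<^esub> v) \<oplus>\<^bsub>T\<^esub> (R #>\<^bsub>F\<^esub> (- u)) = R #>\<^bsub>F\<^esub> (v - u)"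
      using * by (simp_all only: coset_add) simp_all
    ultimately show ?case by simp
  next
    case (of a)
    obtain x y where a: "a = (x, y)" and xy: "x \<in> carrier M" "y \<in> carrier N" using of by auto
    have "R #>\<^bsub>F\<^esub> (- frag_of (x, y)) \<in> carrier T" using xy by (auto simp: carrier_tensor)
    moreover have "(R #>\<^bsub>F\<^esub> (- frag_of (x, y))) \<oplus>\<^bsub>T\<^esub> t x y = R #>\<^bsub>F\<^esub> 0"
      using xy by (simp add: pure_tensor_def coset_add)
    moreover have "R #>\<^bsub>F\<^esub> 0 = \<zero>\<^bsub>T\<^esub>"
      using F.coset_join2 [of 0] R.one_closed subgroup_tensor_rel
      by (simp add: tensor_def)
    ultimately have "R #>\<^bsub>F\<^esub> (- frag_of (x, y)) = t (\<ominus>\<^bsub>M\<^esub> x) y"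
      using xy by (metis T.minus_equality pure_closed pure_minus_left)
    with pure [of x y] pure [of "\<ominus>\<^bsub>M\<^esub> x" y] xy show ?case
      by (simp add: a pure_tensor_def)
  qed
  with z show ?thesis by simp
qed

text \<open>A balanced biadditive map extends to the free abelian group, and the extension kills
  \<open>R\<close>. The target is an arbitrary commutative group, so that the twisted group, into
  which the non-linear 3-map is lifted, is admissible.\<close>

lemma tensor_lift:
  assumes "comm_group G"
    and closed: "\<And>x y. \<lbrakk>x \<in> carrier M; y \<in> carrier N\<rbrakk> \<Longrightarrow> \<phi> x y \<in> carrier G"
    and "\<And>x x' y. \<lbrakk>x \<in> carrier M; x' \<in> carrier M; y \<in> carrier N\<rbrakk>
      \<Longrightarrow> \<phi> (x \<oplus>\<^bsub>M\<^esub> x') y = \<phi> x y \<otimes>\<^bsub>G\<^esub> \<phi> x' y"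
    and "\<And>x y y'. \<lbrakk>x \<in> carrier M; y \<in> carrier N; y' \<in> carrier N\<rbrakk>
      \<Longrightarrow> \<phi> x (y \<oplus>\<^bsub>N\<^esub> y') = \<phi> x y \<otimes>\<^bsub>G\<^esub> \<phi> x y'"
    and "\<And>c x y. \<lbrakk>c \<in> carrier K; x \<in> carrier M; y \<in> carrier N\<rbrakk>
      \<Longrightarrow> \<phi> (c \<odot>\<^bsub>M\<^esub> x) y = \<phi> x (c \<odot>\<^bsub>N\<^esub> y)"
  obtains h where "h \<in> hom (add_monoid T) G"
    "\<And>x y. \<lbrakk>x \<in> carrier M; y \<in> carrier N\<rbrakk> \<Longrightarrow> h (t x y) = \<phi> x y"
proof -
  interpret G: comm_group G by fact
  have "(\<lambda>(x, y). \<phi> x y) ` (carrier M \<times> carrier N) \<subseteq> carrier G" using closed by auto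
  then obtain g where g: "g \<in> hom F G"
    and gof: "\<And>p. p \<in> carrier M \<times> carrier N \<Longrightarrow> g (frag_of p) = (\<lambda>(x, y). \<phi> x y) p"
    unfolding tensor_free_def using G.free_Abelian_group_universal by metis
  interpret g: group_hom F G g
    using g by (simp add: group_hom_def group_hom_axioms_def F.is_group)
  have "R \<subseteq> kernel F G g"
    by (rule tensor_rel_subset_kernel) (use assms gof g in \<open>auto simp: G.is_group\<close>)
  then obtain h where "h \<in> hom (F Mod R) G" "\<And>u. u \<in> carrier F \<Longrightarrow> h (R #>\<^bsub>F\<^esub> u) = g u"
    using g.FactGroup_universal_kernel [OF R.normal_axioms] by metis
  then show thesis
    using gof by (intro that) (auto simp: hom_add_monoid_tensor pure_tensor_def)
qed

section \<open>Scalar multiplication\<close>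

lemma keys_scale:
  assumes "c \<in> carrier K" "u \<in> carrier F"
  shows "frag_extend (\<lambda>(x, y). frag_of (c \<odot>\<^bsub>M\<^esub> x, y)) u \<in> carrier F"
  using keys_frag_extend [of "\<lambda>(x, y). frag_of (c \<odot>\<^bsub>M\<^esub> x, y)" u] assms by fastforce

text \<open>Scaling representatives maps \<open>R\<close> into itself, so the image of a coset lies
  in a single coset, and adding \<open>R\<close> fills that coset up.\<close>

lemma smult_coset:
  assumes c: "c \<in> carrier K" and u: "u \<in> carrier F"
  shows "c \<odot>\<^bsub>T\<^esub> (R #>\<^bsub>F\<^esub> u) = R #>\<^bsub>F\<^esub> frag_extend (\<lambda>(x, y). frag_of (c \<odot>\<^bsub>M\<^esub> x, y)) u"
proof -
  let ?s = "frag_extend (\<lambda>(x, y). frag_of (c \<odot>\<^bsub>M\<^esub> x, y))"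
  have "(\<lambda>u. R #>\<^bsub>F\<^esub> ?s u) \<in> hom F (F Mod R)"
    using keys_scale [OF c] R.rcos_sum
    by (auto simp: hom_def carrier_FactGroup frag_extend_add simp del: F_simps(1))
  moreover have "R #>\<^bsub>F\<^esub> frag_of (x, y) = t x y" for x y by (simp add: pure_tensor_def)
  \<comment> \<open>The scaled map is still balanced because \<open>K\<close> is commutative:
    \<open>c (d x) = d (c x)\<close>.\<close>
  moreover have "t (c \<odot>\<^bsub>M\<^esub> (d \<odot>\<^bsub>M\<^esub> x)) y = t (c \<odot>\<^bsub>M\<^esub> x) (d \<odot>\<^bsub>N\<^esub> y)"
    if "d \<in> carrier K" "x \<in> carrier M" "y \<in> carrier N" for d x y
    using that c pure_smult [of d "c \<odot>\<^bsub>M\<^esub> x" y] M.smult_assoc1 M.m_comm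
    by (metis M.smult_closed)
  moreover note tensor_sel(2) [symmetric]
  ultimately have ker: "R \<subseteq> kernel F (F Mod R) (\<lambda>u. R #>\<^bsub>F\<^esub> ?s u)"
    using c pure_add_left pure_add_right
    by (intro tensor_rel_subset_kernel)
      (simp_all add: Q.is_group M.smult_r_distr del: mult_FactGroup F_simps)
  have R: "?s r \<in> R" if "r \<in> R" for r
  proof (rule F.coset_join1 [OF _ _ subgroup_tensor_rel])
    show "R #>\<^bsub>F\<^esub> ?s r = R"
      using subsetD [OF ker that] by (simp add: kernel_def)
    show "?s r \<in> carrier F"
      using keys_scale [OF c] that R.subset by blast
  qed
  have su: "?s u \<in> carrier F" by (rule keys_scale [OF c u])
  have "?s ` (R #>\<^bsub>F\<^esub> u) \<subseteq> R #>\<^bsub>F\<^esub> ?s u"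
  proof
    fix w assume "w \<in> ?s ` (R #>\<^bsub>F\<^esub> u)"
    then obtain r where "r \<in> R" "w = ?s (r + u)" by (auto simp: r_coset_def)
    then show "w \<in> R #>\<^bsub>F\<^esub> ?s u"
      using F.rcosI [OF R R.subset su] by (simp add: frag_extend_add)
  qed
  moreover have "?s u \<in> ?s ` (R #>\<^bsub>F\<^esub> u)"
    using F.rcos_self [OF u subgroup_tensor_rel] by blast
  moreover have "R <#>\<^bsub>F\<^esub> (R #>\<^bsub>F\<^esub> ?s u) = R #>\<^bsub>F\<^esub> ?s u"
    by (rule R.rcosets_mult_eq [OF F.rcosetsI [OF R.subset su]])
  moreover have "R #>\<^bsub>F\<^esub> ?s u = R <#>\<^bsub>F\<^esub> {?s u}"
    by (simp add: set_mult_def r_coset_def)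
  \<comment> \<open>The set is squeezed between \<open>R + {?s u}\<close> and
    \<open>R + (R + ?s u)\<close>, both of which are the coset of \<open>?s u\<close>.\<close>
  ultimately have "R <#>\<^bsub>F\<^esub> ?s ` (R #>\<^bsub>F\<^esub> u) = R #>\<^bsub>F\<^esub> ?s u"
    using mono_set_mult [OF subset_refl, of "{?s u}" "?s ` (R #>\<^bsub>F\<^esub> u)" F R]
      mono_set_mult [OF subset_refl, of "?s ` (R #>\<^bsub>F\<^esub> u)" "R #>\<^bsub>F\<^esub> ?s u" F R] by blast
  then show ?thesis by (simp add: tensor_def)
qed

lemma smult_pure [simp]:
  "\<lbrakk>c \<in> carrier K; x \<in> carrier M; y \<in> carrier N\<rbrakk> \<Longrightarrow> c \<odot>\<^bsub>T\<^esub> t x y = t (c \<odot>\<^bsub>M\<^esub> x) y"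
  by (simp add: pure_tensor_def smult_coset)

lemma tensor_smult_add:
  assumes "c \<in> carrier K" "z \<in> carrier T" "w \<in> carrier T"
  shows "c \<odot>\<^bsub>T\<^esub> (z \<oplus>\<^bsub>T\<^esub> w) = c \<odot>\<^bsub>T\<^esub> z \<oplus>\<^bsub>T\<^esub> c \<odot>\<^bsub>T\<^esub> w"
proof -
  obtain u v where uv: "u \<in> carrier F" "v \<in> carrier F"
    and [simp]: "z = R #>\<^bsub>F\<^esub> u" "w = R #>\<^bsub>F\<^esub> v"
    using assms by (auto simp: carrier_tensor)
  have "u + v \<in> carrier F" using F.m_closed [OF uv] by simp
  with uv assms(1) show ?thesis
    by (simp add: coset_add smult_coset frag_extend_add keys_scale del: F_simps(1))
qed

lemma tensor_smult_closed: "\<lbrakk>c \<in> carrier K; z \<in> carrier T\<rbrakk> \<Longrightarrow> c \<odot>\<^bsub>T\<^esub> z \<in> carrier T"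
  using keys_scale unfolding carrier_tensor by (auto simp only: smult_coset)

sublocale T: module K T
proof (rule moduleI)
  show "(a \<oplus> b) \<odot>\<^bsub>T\<^esub> z = (a \<odot>\<^bsub>T\<^esub> z) \<oplus>\<^bsub>T\<^esub> (b \<odot>\<^bsub>T\<^esub> z)"
    if "a \<in> carrier K" "b \<in> carrier K" "z \<in> carrier T" for a b z
    using that(3) by (induction z rule: tensor_induct)
      (use that in \<open>simp_all add: M.smult_l_distr pure_add_left tensor_smult_add tensor_smult_closed T.add.m_ac\<close>)
  show "(a \<otimes> b) \<odot>\<^bsub>T\<^esub> z = a \<odot>\<^bsub>T\<^esub> (b \<odot>\<^bsub>T\<^esub> z)"
    if "a \<in> carrier K" "b \<in> carrier K" "z \<in> carrier T" for a b z
    using that(3) by (induction z rule: tensor_induct)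
      (use that in \<open>simp_all add: M.smult_assoc1 tensor_smult_add tensor_smult_closed\<close>)
  show "\<one> \<odot>\<^bsub>T\<^esub> z = z" if "z \<in> carrier T" for z
    using that by (induction z rule: tensor_induct) (simp_all add: tensor_smult_add)
qed (simp_all add: M.is_cring T.abelian_group_axioms tensor_smult_add tensor_smult_closed)

text \<open>The universal property is used twice: \<open>\<beta> x y\<close> lifts the second factor
  for a fixed elementary tensor in the first, then \<open>\<gamma> w\<close> lifts the first factor
  for a fixed element \<open>w\<close> in the second.\<close>

lemma tensor_bilinear_extension:
  assumes closed: "\<And>x y x' y'. \<lbrakk>x \<in> carrier M; y \<in> carrier N; x' \<in> carrier M; y' \<in> carrier N\<rbrakk>
      \<Longrightarrow> q x y x' y' \<in> carrier T"
    and add1: "\<And>x u y x' y'. \<lbrakk>x \<in> carrier M; u \<in> carrier M; y \<in> carrier N; x' \<in> carrier M; y' \<in> carrier N\<rbrakk>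
      \<Longrightarrow> q (x \<oplus>\<^bsub>M\<^esub> u) y x' y' = q x y x' y' \<oplus>\<^bsub>T\<^esub> q u y x' y'"
    and add2: "\<And>x y v x' y'. \<lbrakk>x \<in> carrier M; y \<in> carrier N; v \<in> carrier N; x' \<in> carrier M; y' \<in> carrier N\<rbrakk>
      \<Longrightarrow> q x (y \<oplus>\<^bsub>N\<^esub> v) x' y' = q x y x' y' \<oplus>\<^bsub>T\<^esub> q x v x' y'"
    and add3: "\<And>x y x' u y'. \<lbrakk>x \<in> carrier M; y \<in> carrier N; x' \<in> carrier M; u \<in> carrier M; y' \<in> carrier N\<rbrakk>
      \<Longrightarrow> q x y (x' \<oplus>\<^bsub>M\<^esub> u) y' = q x y x' y' \<oplus>\<^bsub>T\<^esub> q x y u y'"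
    and add4: "\<And>x y x' y' v. \<lbrakk>x \<in> carrier M; y \<in> carrier N; x' \<in> carrier M; y' \<in> carrier N; v \<in> carrier N\<rbrakk>
      \<Longrightarrow> q x y x' (y' \<oplus>\<^bsub>N\<^esub> v) = q x y x' y' \<oplus>\<^bsub>T\<^esub> q x y x' v"
    and smult: "\<And>c x y x' y'. \<lbrakk>c \<in> carrier K; x \<in> carrier M; y \<in> carrier N; x' \<in> carrier M; y' \<in> carrier N\<rbrakk>
      \<Longrightarrow> q (c \<odot>\<^bsub>M\<^esub> x) y x' y' = c \<odot>\<^bsub>T\<^esub> q x y x' y' \<and> q x (c \<odot>\<^bsub>N\<^esub> y) x' y' = c \<odot>\<^bsub>T\<^esub> q x y x' y'
        \<and> q x y (c \<odot>\<^bsub>M\<^esub> x') y' = c \<odot>\<^bsub>T\<^esub> q x y x' y' \<and> q x y x' (c \<odot>\<^bsub>N\<^esub> y') = c \<odot>\<^bsub>T\<^esub> q x y x' y'"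
  obtains b where "bilinear_op K T b"
    "\<And>x y x' y'. \<lbrakk>x \<in> carrier M; y \<in> carrier N; x' \<in> carrier M; y' \<in> carrier N\<rbrakk>
      \<Longrightarrow> b (t x y) (t x' y') = q x y x' y'"
proof -
  have "\<exists>h. h \<in> hom (add_monoid T) (add_monoid T) \<and>
      (\<forall>x'\<in>carrier M. \<forall>y'\<in>carrier N. h (t x' y') = q x y x' y')"
    if "x \<in> carrier M" "y \<in> carrier N" for x y
    by (rule tensor_lift [OF T.a_comm_group, of "q x y"])
      (use that closed add3 add4 smult in auto)
  then obtain \<beta> where hom: "\<And>x y. \<lbrakk>x \<in> carrier M; y \<in> carrier N\<rbrakk> \<Longrightarrow> \<beta> x y \<in> hom (add_monoid T) (add_monoid T)"
    and \<beta>: "\<And>x y x' y'. \<lbrakk>x \<in> carrier M; y \<in> carrier N; x' \<in> carrier M; y' \<in> carrier N\<rbrakk>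
      \<Longrightarrow> \<beta> x y (t x' y') = q x y x' y'"
    by metis
  have \<beta>_closed: "\<beta> x y w \<in> carrier T"
    if "x \<in> carrier M" "y \<in> carrier N" "w \<in> carrier T" for x y w
    using hom that by (auto simp: hom_def)
  have \<beta>_add: "\<beta> x y (w \<oplus>\<^bsub>T\<^esub> w') = \<beta> x y w \<oplus>\<^bsub>T\<^esub> \<beta> x y w'"
    if "x \<in> carrier M" "y \<in> carrier N" "w \<in> carrier T" "w' \<in> carrier T" for x y w w'
    using hom [of x y] that by (auto simp: hom_def)
  \<comment> \<open>Linearity of \<open>\<beta>\<close> in \<open>x\<close> and in \<open>y\<close>
    is known only at elementary tensors \<open>w\<close>; induction on \<open>w\<close> carries it
    to all of \<open>T\<close>, which the second lift requires.\<close>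
  have \<beta>1: "\<beta> (x \<oplus>\<^bsub>M\<^esub> u) y w = \<beta> x y w \<oplus>\<^bsub>T\<^esub> \<beta> u y w"
    if "x \<in> carrier M" "u \<in> carrier M" "y \<in> carrier N" "w \<in> carrier T" for x u y w
    using that(4) by (induction w rule: tensor_induct)
      (use that in \<open>simp_all add: \<beta> add1 \<beta>_add \<beta>_closed T.add.m_ac\<close>)
  have \<beta>2: "\<beta> x (y \<oplus>\<^bsub>N\<^esub> v) w = \<beta> x y w \<oplus>\<^bsub>T\<^esub> \<beta> x v w"
    if "x \<in> carrier M" "y \<in> carrier N" "v \<in> carrier N" "w \<in> carrier T" for x y v w
    using that(4) by (induction w rule: tensor_induct)
      (use that in \<open>simp_all add: \<beta> add2 \<beta>_add \<beta>_closed T.add.m_ac\<close>)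
  have \<beta>_smult: "\<beta> (c \<odot>\<^bsub>M\<^esub> x) y w = c \<odot>\<^bsub>T\<^esub> \<beta> x y w \<and> \<beta> x (c \<odot>\<^bsub>N\<^esub> y) w = c \<odot>\<^bsub>T\<^esub> \<beta> x y w
      \<and> \<beta> x y (c \<odot>\<^bsub>T\<^esub> w) = c \<odot>\<^bsub>T\<^esub> \<beta> x y w"
    if "c \<in> carrier K" "x \<in> carrier M" "y \<in> carrier N" "w \<in> carrier T" for c x y w
    using that(4) by (induction w rule: tensor_induct)
      (use that in \<open>simp_all add: \<beta> smult \<beta>_add \<beta>_closed T.smult_r_distr\<close>)
  have "\<exists>h. h \<in> hom (add_monoid T) (add_monoid T) \<and>
      (\<forall>x\<in>carrier M. \<forall>y\<in>carrier N. h (t x y) = \<beta> x y w)"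
    if "w \<in> carrier T" for w
    by (rule tensor_lift [OF T.a_comm_group, of "\<lambda>x y. \<beta> x y w"])
      (use that \<beta>_closed \<beta>1 \<beta>2 \<beta>_smult in auto)
  then obtain \<gamma> where hom\<gamma>: "\<And>w. w \<in> carrier T \<Longrightarrow> \<gamma> w \<in> hom (add_monoid T) (add_monoid T)"
    and \<gamma>: "\<And>w x y. \<lbrakk>w \<in> carrier T; x \<in> carrier M; y \<in> carrier N\<rbrakk> \<Longrightarrow> \<gamma> w (t x y) = \<beta> x y w"
    by metis
  have \<gamma>_closed: "\<gamma> w z \<in> carrier T" if "w \<in> carrier T" "z \<in> carrier T" for w z
    using hom\<gamma> that by (auto simp: hom_def)
  have \<gamma>_add: "\<gamma> w (z \<oplus>\<^bsub>T\<^esub> z') = \<gamma> w z \<oplus>\<^bsub>T\<^esub> \<gamma> w z'"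
    if "w \<in> carrier T" "z \<in> carrier T" "z' \<in> carrier T" for w z z'
    using hom\<gamma> [of w] that by (auto simp: hom_def)
  have \<gamma>1: "\<gamma> (w \<oplus>\<^bsub>T\<^esub> w') z = \<gamma> w z \<oplus>\<^bsub>T\<^esub> \<gamma> w' z"
    if "w \<in> carrier T" "w' \<in> carrier T" "z \<in> carrier T" for w w' z
    using that(3) by (induction z rule: tensor_induct)
      (use that in \<open>simp_all add: \<gamma> \<beta>_add \<beta>_closed \<gamma>_add \<gamma>_closed T.add.m_ac\<close>)
  have \<gamma>_smult: "\<gamma> (c \<odot>\<^bsub>T\<^esub> w) z = c \<odot>\<^bsub>T\<^esub> \<gamma> w z \<and> \<gamma> w (c \<odot>\<^bsub>T\<^esub> z) = c \<odot>\<^bsub>T\<^esub> \<gamma> w z"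
    if "c \<in> carrier K" "w \<in> carrier T" "z \<in> carrier T" for c w z
    using that(3) by (induction z rule: tensor_induct)
      (use that in \<open>simp_all add: \<gamma> \<beta>_smult \<gamma>_add \<gamma>_closed T.smult_r_distr\<close>)
  show thesis
  proof (rule that)
    \<comment> \<open>\<open>\<gamma>\<close> takes the second factor first, hence the swapped
      arguments.\<close>
    show "bilinear_op K T (\<lambda>z w. \<gamma> w z)"
      by (simp add: bilinear_op_def \<gamma>_closed \<gamma>_add \<gamma>1 \<gamma>_smult)
  qed (simp add: \<gamma> \<beta>)
qed

end

section \<open>Lie and post-Lie algebras in characteristic 3\<close>

locale abelian_group3 = abelian_group V for V (structure) +
  assumes three: "x \<in> carrier V \<Longrightarrow> x \<oplus> (x \<oplus> x) = \<zero>"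
begin

lemma three_left: "\<lbrakk>x \<in> carrier V; y \<in> carrier V\<rbrakk> \<Longrightarrow> x \<oplus> (x \<oplus> (x \<oplus> y)) = y"
  using three a_assoc a_closed l_zero by metis

lemma minus3: "x \<in> carrier V \<Longrightarrow> \<ominus> x = x \<oplus> x"
  by (simp add: minus_equality three a_assoc)

lemma add_pow2: "x \<in> carrier V \<Longrightarrow> add_pow V (2::nat) x = x \<oplus> x"
  by (simp add: add_pow_def numeral_2_eq_2 nat_pow_def)

text \<open>With negation written as doubling and triples cancelled, sums take a normal form without
  signs, which the simplifier can compare.\<close>

lemmas normal3 = a_assoc a_comm a_lcomm three three_left minus3 a_minus_def add_pow2

end

lemma (in module) abelian_group3I:
  assumes "ring_char R = 3"
  shows "abelian_group3 M"
proof
  fix x assume x: "x \<in> carrier M"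
  have "add_pow R (3::nat) \<one> = \<zero>"
    using R.add.pow_ord_eq_1 [of \<one>] assms by (simp add: ring_char_def add_pow_def)
  then have "\<one> \<oplus> (\<one> \<oplus> \<one>) = \<zero>"
    by (simp add: add_pow_def numeral_3_eq_3 nat_pow_def R.a_assoc)
  then have "(\<one> \<oplus> (\<one> \<oplus> \<one>)) \<odot>\<^bsub>M\<^esub> x = \<zero>\<^bsub>M\<^esub>" using x by simp
  then show "x \<oplus>\<^bsub>M\<^esub> (x \<oplus>\<^bsub>M\<^esub> x) = \<zero>\<^bsub>M\<^esub>" using x by (simp add: smult_l_distr)
qed

lemma bilinear_opD:
  assumes "bilinear_op K V b"
  shows "\<lbrakk>x \<in> carrier V; y \<in> carrier V\<rbrakk> \<Longrightarrow> b x y \<in> carrier V"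
    and "\<lbrakk>x \<in> carrier V; y \<in> carrier V; z \<in> carrier V\<rbrakk>
      \<Longrightarrow> b (x \<oplus>\<^bsub>V\<^esub> y) z = b x z \<oplus>\<^bsub>V\<^esub> b y z"
    and "\<lbrakk>x \<in> carrier V; y \<in> carrier V; z \<in> carrier V\<rbrakk>
      \<Longrightarrow> b x (y \<oplus>\<^bsub>V\<^esub> z) = b x y \<oplus>\<^bsub>V\<^esub> b x z"
    and "\<lbrakk>c \<in> carrier K; x \<in> carrier V; y \<in> carrier V\<rbrakk> \<Longrightarrow> b (c \<odot>\<^bsub>V\<^esub> x) y = c \<odot>\<^bsub>V\<^esub> b x y"
    and "\<lbrakk>c \<in> carrier K; x \<in> carrier V; y \<in> carrier V\<rbrakk> \<Longrightarrow> b x (c \<odot>\<^bsub>V\<^esub> y) = c \<odot>\<^bsub>V\<^esub> b x y"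
  using assms by (auto simp: bilinear_op_def)

lemma (in abelian_group) additive_zero:
  assumes "h \<zero> \<in> carrier G" "h (\<zero> \<oplus> \<zero>) = h \<zero> \<oplus> h \<zero>"
  shows "h \<zero> = \<zero>"
  using assms by (metis add.r_cancel_one' l_zero zero_closed)

section \<open>Lie algebras in characteristic 3 and the Jacobson correction\<close>

locale lie_algebra_char3 = lie_algebra K L br
  for K (structure) and L (structure) and br +
  assumes char_K: "ring_char K = 3"
begin

sublocale abelian_group3 L by (rule abelian_group3I [OF char_K])

lemmas br_closed [simp] = bilinear_opD(1) [OF br_bilinear]
lemmas br_add_left [simp] = bilinear_opD(2) [OF br_bilinear]
lemmas br_add_right [simp] = bilinear_opD(3) [OF br_bilinear]
lemmas br_smult_left [simp] = bilinear_opD(4) [OF br_bilinear]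
lemmas br_smult_right [simp] = bilinear_opD(5) [OF br_bilinear]

lemma br_zero_left [simp]: "y \<in> carrier L \<Longrightarrow> br \<zero>\<^bsub>L\<^esub> y = \<zero>\<^bsub>L\<^esub>"
  by (rule M.additive_zero [of "\<lambda>x. br x y"]) (simp_all flip: br_add_left)

lemma br_zero_right [simp]: "x \<in> carrier L \<Longrightarrow> br x \<zero>\<^bsub>L\<^esub> = \<zero>\<^bsub>L\<^esub>"
  by (rule M.additive_zero [of "br x"]) (simp_all flip: br_add_right)

lemma br_skew:
  assumes "x \<in> carrier L" "y \<in> carrier L"
  shows "br y x = \<ominus>\<^bsub>L\<^esub> br x y"
proof -
  have "br (x \<oplus>\<^bsub>L\<^esub> y) (x \<oplus>\<^bsub>L\<^esub> y) = \<zero>\<^bsub>L\<^esub>" using assms br_alternating by simp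
  then have "br y x \<oplus>\<^bsub>L\<^esub> br x y = \<zero>\<^bsub>L\<^esub>"
    using assms br_alternating [of x] br_alternating [of y] by (simp add: M.a_comm)
  then show ?thesis using assms by (simp add: M.minus_equality)
qed

lemma br_skew3: "\<lbrakk>x \<in> carrier L; y \<in> carrier L\<rbrakk> \<Longrightarrow> br y x = br x y \<oplus>\<^bsub>L\<^esub> br x y"
  by (metis br_skew br_closed minus3)

text \<open>The Jacobi identity with doubling in the place of the minus sign. As a rewrite rule it
  turns nested brackets into right-normed ones.\<close>

lemma br_leibniz:
  assumes "x \<in> carrier L" "y \<in> carrier L" "z \<in> carrier L"
  shows "br (br x y) z = br x (br y z) \<oplus>\<^bsub>L\<^esub> (br y (br x z) \<oplus>\<^bsub>L\<^esub> br y (br x z))"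
proof -
  have eq: "br x (br y z) \<oplus>\<^bsub>L\<^esub> (br y (br z x) \<oplus>\<^bsub>L\<^esub> br z (br x y)) = \<zero>\<^bsub>L\<^esub>"
    using br_jacobi [OF assms] assms by (simp add: M.a_assoc)
  have "br (br x y) z = br z (br x y) \<oplus>\<^bsub>L\<^esub> br z (br x y)" using assms by (intro br_skew3) simp_all
  also have "\<dots> = \<ominus>\<^bsub>L\<^esub> br z (br x y)" using assms by (simp add: minus3)
  also have "\<dots> = br x (br y z) \<oplus>\<^bsub>L\<^esub> br y (br z x)"
    using eq assms by (intro M.minus_equality) (simp_all add: M.a_assoc)
  also have "br y (br z x) = br y (br x z) \<oplus>\<^bsub>L\<^esub> br y (br x z)"
    using assms br_skew3 [of x z] by simp
  finally show ?thesis .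
qed

text \<open>Not the Jacobiator but the deviation of a 3-map from additivity, the sum of the Jacobson
  terms \<open>s_2\<close> and \<open>s_1\<close>.\<close>

definition jac :: "'c \<Rightarrow> 'c \<Rightarrow> 'c" where
  "jac x y = br x (br x y) \<oplus>\<^bsub>L\<^esub> br y (br y x)"

lemma jac_closed [simp]: "\<lbrakk>x \<in> carrier L; y \<in> carrier L\<rbrakk> \<Longrightarrow> jac x y \<in> carrier L"
  by (simp add: jac_def)

lemma jac_commute: "\<lbrakk>x \<in> carrier L; y \<in> carrier L\<rbrakk> \<Longrightarrow> jac x y = jac y x"
  by (simp add: jac_def M.a_comm)

lemma jac_zero [simp]:
  "x \<in> carrier L \<Longrightarrow> jac \<zero>\<^bsub>L\<^esub> x = \<zero>\<^bsub>L\<^esub>" "x \<in> carrier L \<Longrightarrow> jac x \<zero>\<^bsub>L\<^esub> = \<zero>\<^bsub>L\<^esub>"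
  by (simp_all add: jac_def)

lemma jac_smult:
  "\<lbrakk>c \<in> carrier K; x \<in> carrier L; y \<in> carrier L\<rbrakk>
    \<Longrightarrow> jac (c \<odot>\<^bsub>L\<^esub> x) (c \<odot>\<^bsub>L\<^esub> y) = (c [^] (3::nat)) \<odot>\<^bsub>L\<^esub> jac x y"
  by (simp add: jac_def smult_r_distr numeral_3_eq_3 smult_assoc1 R.m_assoc)

text \<open>All terms in two of the variables cancel. What remains of the difference is
  \<open>[x,[y,z]] + 2 [y,[x,z]] + [z,[x,y]]\<close>, which is the Jacobi sum because
  \<open>-2 = 1\<close>.\<close>

lemma jac_cocycle:
  assumes "x \<in> carrier L" "y \<in> carrier L" "z \<in> carrier L"
  shows "jac x y \<oplus>\<^bsub>L\<^esub> jac (x \<oplus>\<^bsub>L\<^esub> y) z = jac y z \<oplus>\<^bsub>L\<^esub> jac x (y \<oplus>\<^bsub>L\<^esub> z)"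
proof -
  \<comment> \<open>\<open>j\<close> and \<open>s\<close> orient the inner brackets and eliminate
    \<open>[z,[x,y]]\<close>, so that both sides become sums of the same monomials.\<close>
  have j: "br z (br x y) = br x (br z y) \<oplus>\<^bsub>L\<^esub> br y (br z x) \<oplus>\<^bsub>L\<^esub> br y (br z x)"
    using assms br_leibniz [of x y z] br_skew3 [of z x] br_skew3 [of z y] br_skew3 [of "br x y" z]
    by (simp add: normal3)
  have s: "br x z = br z x \<oplus>\<^bsub>L\<^esub> br z x" "br y z = br z y \<oplus>\<^bsub>L\<^esub> br z y" "br y x = br x y \<oplus>\<^bsub>L\<^esub> br x y"
    by (intro br_skew3 assms)+
  show ?thesis
    using assms by (simp add: jac_def s j normal3)
qed

text \<open>A homomorphism \<open>x \<mapsto> (x, s x)\<close> into this group is the same as a map \<open>s\<close> satisfying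
  Jacobson's formula.\<close>

definition twisted :: "('c \<times> 'c) monoid" where
  "twisted = \<lparr>carrier = carrier L \<times> carrier L,
     monoid.mult = (\<lambda>(x, u) (y, v). (x \<oplus>\<^bsub>L\<^esub> y, u \<oplus>\<^bsub>L\<^esub> v \<oplus>\<^bsub>L\<^esub> jac x y)),
     one = (\<zero>\<^bsub>L\<^esub>, \<zero>\<^bsub>L\<^esub>)\<rparr>"

text \<open>Associativity is the cocycle identity and commutativity the symmetry of
  \<open>jac\<close>. The inverse is componentwise doubling, that is negation, because
  \<open>jac\<close> vanishes on multiples of one element.\<close>

lemma comm_group_twisted: "comm_group twisted"
proof (rule comm_groupI)
  fix p q r assume "p \<in> carrier twisted" "q \<in> carrier twisted" "r \<in> carrier twisted"
  then show "p \<otimes>\<^bsub>twisted\<^esub> q \<otimes>\<^bsub>twisted\<^esub> r = p \<otimes>\<^bsub>twisted\<^esub> (q \<otimes>\<^bsub>twisted\<^esub> r)"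
    using jac_cocycle [of "fst p" "fst q" "fst r"]
    by (auto simp: twisted_def M.a_assoc) (metis M.a_lcomm jac_closed M.a_closed)
next
  fix p assume p: "p \<in> carrier twisted"
  then show "\<exists>q\<in>carrier twisted. q \<otimes>\<^bsub>twisted\<^esub> p = \<one>\<^bsub>twisted\<^esub>"
    by (intro bexI [of _ "(fst p \<oplus>\<^bsub>L\<^esub> fst p, snd p \<oplus>\<^bsub>L\<^esub> snd p)"])
      (auto simp: twisted_def jac_def br_alternating normal3)
qed (auto simp: twisted_def jac_commute M.a_comm)

text \<open>Jacobson's formula for the linear maps \<open>ad x\<close> and \<open>ad y\<close> under
  composition, where \<open>ad\<close> carries \<open>jac x y\<close> to the correction term. It
  makes the identity \<open>br (pm x) y = br x (br x (br x y))\<close> stable under sums in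
  \<open>x\<close>.\<close>

lemma ad_add_cube:
  assumes "x \<in> carrier L" "y \<in> carrier L" "w \<in> carrier L"
  shows "br (x \<oplus>\<^bsub>L\<^esub> y) (br (x \<oplus>\<^bsub>L\<^esub> y) (br (x \<oplus>\<^bsub>L\<^esub> y) w)) =
    br x (br x (br x w)) \<oplus>\<^bsub>L\<^esub> br y (br y (br y w)) \<oplus>\<^bsub>L\<^esub> br (jac x y) w"
  using assms by (simp add: jac_def br_leibniz normal3)

text \<open>Compatibility of a derivation of the bracket with Jacobson's formula; \<open>dy\<close> and \<open>dz\<close> stand
  for its values at \<open>y\<close> and \<open>z\<close>.\<close>

lemma derivation_jac:
  assumes "y \<in> carrier L" "z \<in> carrier L" "dy \<in> carrier L" "dz \<in> carrier L"
  shows "br (y \<oplus>\<^bsub>L\<^esub> z) (br (y \<oplus>\<^bsub>L\<^esub> z) (dy \<oplus>\<^bsub>L\<^esub> dz)) =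
    br y (br y dy) \<oplus>\<^bsub>L\<^esub> br z (br z dz) \<oplus>\<^bsub>L\<^esub>
    (br dy (br y z) \<oplus>\<^bsub>L\<^esub> br y (br dy z \<oplus>\<^bsub>L\<^esub> br y dz) \<oplus>\<^bsub>L\<^esub>
     (br dz (br z y) \<oplus>\<^bsub>L\<^esub> br z (br dz y \<oplus>\<^bsub>L\<^esub> br z dy)))"
proof -
  \<comment> \<open>\<open>s\<close> and \<open>j\<close> move \<open>dy\<close> and
    \<open>dz\<close> to the innermost right position, where the monomials on both sides can be
    matched.\<close>
  have s: "br d u = br u d \<oplus>\<^bsub>L\<^esub> br u d" if "d \<in> {dy, dz}" "u \<in> {y, z}" for d u
    using that assms by (intro br_skew3) auto
  have j: "br d (br u v) = br v (br u d) \<oplus>\<^bsub>L\<^esub> br u (br v d) \<oplus>\<^bsub>L\<^esub> br u (br v d)"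
    if "d \<in> {dy, dz}" "u \<in> {y, z}" "v \<in> {y, z}" for d u v
  proof -
    have c: "d \<in> carrier L" "u \<in> carrier L" "v \<in> carrier L" using that assms by auto
    then have "br d (br u v) = br (br u v) d \<oplus>\<^bsub>L\<^esub> br (br u v) d" by (intro br_skew3) simp_all
    with c show ?thesis by (simp add: br_leibniz normal3)
  qed
  show ?thesis using assms by (simp add: s j normal3)
qed

end

section \<open>Post-Lie algebras: additivity of the cubic identity up to the Jacobson
  correction\<close>

locale post_lie_algebra_char3 = lie_algebra_char3 K L br + post_lie_algebra K L br pr
  for K (structure) and L (structure) and br and pr
begin

lemmas pr_closed [simp] = bilinear_opD(1) [OF pr_bilinear]
lemmas pr_add_left [simp] = bilinear_opD(2) [OF pr_bilinear]
lemmas pr_add_right [simp] = bilinear_opD(3) [OF pr_bilinear]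

lemma br_pr_expand:
  "\<lbrakk>x \<in> carrier L; y \<in> carrier L; z \<in> carrier L\<rbrakk> \<Longrightarrow> pr (br x y) z =
    (pr x (pr y z) \<ominus>\<^bsub>L\<^esub> pr (pr x y) z) \<ominus>\<^bsub>L\<^esub> (pr y (pr x z) \<ominus>\<^bsub>L\<^esub> pr (pr y x) z)"
  using br_pr by (simp add: associator_def)

text \<open>Trilinear in \<open>u\<close>, \<open>v\<close>, \<open>w\<close>; on the diagonal this is the right-hand side of \<open>pm_pr\<close>.\<close>

definition cube_terms :: "'c \<Rightarrow> 'c \<Rightarrow> 'c \<Rightarrow> 'c \<Rightarrow> 'c" where
  "cube_terms u v w y = pr u (pr v (pr w y)) \<oplus>\<^bsub>L\<^esub> add_pow L (2::nat) (pr (pr u v) (pr w y))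
     \<oplus>\<^bsub>L\<^esub> pr u (pr (pr v w) y) \<oplus>\<^bsub>L\<^esub> pr (pr (pr u v) w) y \<oplus>\<^bsub>L\<^esub> pr (pr u (pr v w)) y"

lemma cube_terms_closed [simp]:
  "\<lbrakk>u \<in> carrier L; v \<in> carrier L; w \<in> carrier L; y \<in> carrier L\<rbrakk> \<Longrightarrow> cube_terms u v w y \<in> carrier L"
  by (simp add: cube_terms_def)

lemma cube_terms_add_right:
  assumes "u \<in> carrier L" "y \<in> carrier L" "z \<in> carrier L"
  shows "cube_terms u u u (y \<oplus>\<^bsub>L\<^esub> z) = cube_terms u u u y \<oplus>\<^bsub>L\<^esub> cube_terms u u u z"
  using assms by (simp add: cube_terms_def normal3)

text \<open>The right-hand side is the part of the cubic form at \<open>x + z\<close> that is linear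
  in \<open>z\<close>. Both post-Lie axioms are used to expand the left-hand side into iterated
  products.\<close>

lemma cube_terms_mixed:
  assumes "x \<in> carrier L" "z \<in> carrier L" "y \<in> carrier L"
  shows "pr (br x (br x z)) y = cube_terms z x x y \<oplus>\<^bsub>L\<^esub> cube_terms x z x y \<oplus>\<^bsub>L\<^esub> cube_terms x x z y"
  using assms by (simp add: cube_terms_def pr_br br_pr_expand normal3)

lemma cube_terms_multilinear:
  assumes "u \<in> carrier L" "u' \<in> carrier L" "v \<in> carrier L" "w \<in> carrier L" "y \<in> carrier L"
  shows "cube_terms (u \<oplus>\<^bsub>L\<^esub> u') v w y = cube_terms u v w y \<oplus>\<^bsub>L\<^esub> cube_terms u' v w y"
    and "cube_terms v (u \<oplus>\<^bsub>L\<^esub> u') w y = cube_terms v u w y \<oplus>\<^bsub>L\<^esub> cube_terms v u' w y"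
    and "cube_terms v w (u \<oplus>\<^bsub>L\<^esub> u') y = cube_terms v w u y \<oplus>\<^bsub>L\<^esub> cube_terms v w u' y"
  using assms by (simp_all add: cube_terms_def normal3)

text \<open>The mixed terms, sorted by degree, are the two instances of
  \<open>cube_terms_mixed\<close>, with \<open>[x,[x,z]]\<close> and \<open>[z,[z,x]]\<close>; these
  add up to \<open>jac x z\<close>.\<close>

lemma cube_terms_add:
  assumes "x \<in> carrier L" "z \<in> carrier L" "y \<in> carrier L"
  shows "cube_terms (x \<oplus>\<^bsub>L\<^esub> z) (x \<oplus>\<^bsub>L\<^esub> z) (x \<oplus>\<^bsub>L\<^esub> z) y =
    cube_terms x x x y \<oplus>\<^bsub>L\<^esub> cube_terms z z z y \<oplus>\<^bsub>L\<^esub> pr (jac x z) y"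
  using assms by (simp add: jac_def cube_terms_mixed cube_terms_multilinear M.a_ac)

end

section \<open>Operations on the tensor product\<close>

text \<open>\<open>L\<close> is kept abstract; derivations enter only in
  \<open>lie_action_tensor3\<close>, through their action on \<open>A\<close>.\<close>

locale lie_tensor3 = A: comm_assoc_algebra K A + L: restricted_lie_algebra3 K L lb lp
  for K :: "('k, 'm) ring_scheme" (structure)
    and A :: "('k, 'a, 'n) module_scheme"
    and L :: "('k, 'b, 'l) module_scheme"
    and lb lp
begin

sublocale LL: lie_algebra_char3 K L lb
  by unfold_locales (rule L.char3)

sublocale AA: abelian_group3 A by (rule A.abelian_group3I [OF L.char3])

sublocale module_pair K A L by unfold_locales

sublocale TT: abelian_group3 T by (rule T.abelian_group3I [OF L.char3])

lemmas mult_closed [simp] = bilinear_opD(1) [OF A.mult_bilinear]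
lemmas mult_add_left [simp] = bilinear_opD(2) [OF A.mult_bilinear]
lemmas mult_add_right [simp] = bilinear_opD(3) [OF A.mult_bilinear]
lemmas mult_smult_left [simp] = bilinear_opD(4) [OF A.mult_bilinear]
lemmas mult_smult_right [simp] = bilinear_opD(5) [OF A.mult_bilinear]

lemma mult_lcomm:
  "\<lbrakk>x \<in> carrier A; y \<in> carrier A; z \<in> carrier A\<rbrakk>
    \<Longrightarrow> x \<otimes>\<^bsub>A\<^esub> (y \<otimes>\<^bsub>A\<^esub> z) = y \<otimes>\<^bsub>A\<^esub> (x \<otimes>\<^bsub>A\<^esub> z)"
  by (metis A.mult_assoc A.mult_comm)

lemmas mult_ac = A.mult_assoc A.mult_comm mult_lcomm

lemma mult_zero_right [simp]: "x \<in> carrier A \<Longrightarrow> x \<otimes>\<^bsub>A\<^esub> \<zero>\<^bsub>A\<^esub> = \<zero>\<^bsub>A\<^esub>"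
  by (rule A.M.additive_zero [of "\<lambda>y. x \<otimes>\<^bsub>A\<^esub> y"]) (simp_all flip: mult_add_right)

lemmas pure_simps = pure_add_left pure_add_right TT.normal3 mult_ac

lemma bracket_exists:
  obtains br where "bilinear_op K T br"
    "\<And>a f b g. \<lbrakk>a \<in> carrier A; f \<in> carrier L; b \<in> carrier A; g \<in> carrier L\<rbrakk>
      \<Longrightarrow> br (t a f) (t b g) = t (a \<otimes>\<^bsub>A\<^esub> b) (lb f g)"
  by (rule tensor_bilinear_extension [of "\<lambda>a f b g. t (a \<otimes>\<^bsub>A\<^esub> b) (lb f g)"])
    (auto simp: pure_add_left pure_add_right simp flip: pure_smult)

lemma bilinear_op_unique:
  assumes b: "bilinear_op K T b" and b': "bilinear_op K T b'"
    and pure: "\<And>a f c g. \<lbrakk>a \<in> carrier A; f \<in> carrier L; c \<in> carrier A; g \<in> carrier L\<rbrakk>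
      \<Longrightarrow> b (t a f) (t c g) = b' (t a f) (t c g)"
    and "x \<in> carrier T" "y \<in> carrier T"
  shows "b x y = b' x y"
proof -
  have "b (t a f) v = b' (t a f) v" if "v \<in> carrier T" "a \<in> carrier A" "f \<in> carrier L" for a f v
    using that(1) by (induction v rule: tensor_induct)
      (use that in \<open>simp_all add: pure bilinear_opD(3) [OF b] bilinear_opD(3) [OF b']\<close>)
  note pure1 = this
  show ?thesis
    using assms(4) by (induction x rule: tensor_induct)
      (use assms(5) in \<open>simp_all add: pure1 bilinear_opD(2) [OF b] bilinear_opD(2) [OF b']\<close>)
qed

text \<open>Jacobson's formula for a given bracket determines the value at a sum from the values at
  the summands.\<close>

lemma cube_map_unique:
  assumes "jacobson3 T b pm" "jacobson3 T b pm'"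
    and "\<And>a f. \<lbrakk>a \<in> carrier A; f \<in> carrier L\<rbrakk> \<Longrightarrow> pm (t a f) = pm' (t a f)"
    and "x \<in> carrier T"
  shows "pm x = pm' x"
  using assms(4) by (induction x rule: tensor_induct) (use assms in \<open>simp_all add: jacobson3_def\<close>)

end

text \<open>The operations are fixed by their characterization rather than as a particular
  construction, so that the results apply to every triple satisfying
  \<open>tensor_operations\<close>.\<close>

locale tensor_bracket = lie_tensor3 +
  fixes br
  assumes tbr_bilinear: "bilinear_op K (tensor K A L) br"
    and br_pure: "\<lbrakk>a \<in> carrier A; f \<in> carrier L; b \<in> carrier A; g \<in> carrier L\<rbrakk>
      \<Longrightarrow> br (pure_tensor K A L a f) (pure_tensor K A L b g) = pure_tensor K A L (a \<otimes>\<^bsub>A\<^esub> b) (lb f g)"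
begin

lemmas tbr_closed [simp] = bilinear_opD(1) [OF tbr_bilinear]
lemmas tbr_add_left [simp] = bilinear_opD(2) [OF tbr_bilinear]
lemmas tbr_add_right [simp] = bilinear_opD(3) [OF tbr_bilinear]

section \<open>The Lie axioms for the bracket\<close>

lemma tbr_antisym:
  assumes "x \<in> carrier T" "y \<in> carrier T"
  shows "br x y \<oplus>\<^bsub>T\<^esub> br y x = \<zero>\<^bsub>T\<^esub>"
  using assms(1)
proof (induction x rule: tensor_induct)
  case (pure a f)
  show ?case using assms(2)
  proof (induction y rule: tensor_induct)
    case (pure b g)
    have "lb g f = lb f g \<oplus>\<^bsub>L\<^esub> lb f g" using \<open>f \<in> _\<close> pure by (intro LL.br_skew3)
    then show ?case using \<open>a \<in> _\<close> \<open>f \<in> _\<close> pure by (simp add: br_pure pure_simps)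
  next
    case (add u v)
    then have "br (t a f) (u \<oplus>\<^bsub>T\<^esub> v) \<oplus>\<^bsub>T\<^esub> br (u \<oplus>\<^bsub>T\<^esub> v) (t a f) =
      (br (t a f) u \<oplus>\<^bsub>T\<^esub> br u (t a f)) \<oplus>\<^bsub>T\<^esub> (br (t a f) v \<oplus>\<^bsub>T\<^esub> br v (t a f))"
      using pure by (simp add: T.add.m_ac)
    with add show ?case by simp
  qed
next
  case (add u v)
  then have "br (u \<oplus>\<^bsub>T\<^esub> v) y \<oplus>\<^bsub>T\<^esub> br y (u \<oplus>\<^bsub>T\<^esub> v) =
      (br u y \<oplus>\<^bsub>T\<^esub> br y u) \<oplus>\<^bsub>T\<^esub> (br v y \<oplus>\<^bsub>T\<^esub> br y v)"
    using assms(2) by (simp add: T.add.m_ac)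
  with add show ?case by simp
qed

text \<open>\<open>br x x\<close> is quadratic in \<open>x\<close>; the cross terms that appear for
  a sum cancel by antisymmetry.\<close>

lemma tbr_alternating:
  assumes "x \<in> carrier T" shows "br x x = \<zero>\<^bsub>T\<^esub>"
  using assms
proof (induction x rule: tensor_induct)
  case (pure a f)
  then show ?case by (simp add: br_pure L.br_alternating)
next
  case (add u v)
  then show ?case using tbr_antisym [of v u] by simp
qed

text \<open>The Jacobi sum \<open>j\<close> is additive in each argument. On elementary tensors it
  is \<open>abc\<close> tensored with the Jacobi sum in \<open>L\<close>.\<close>

lemma tbr_jacobi:
  assumes "x \<in> carrier T" "y \<in> carrier T" "z \<in> carrier T"
  shows "br x (br y z) \<oplus>\<^bsub>T\<^esub> br y (br z x) \<oplus>\<^bsub>T\<^esub> br z (br x y) = \<zero>\<^bsub>T\<^esub>"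
proof -
  define j where "j x y z = br x (br y z) \<oplus>\<^bsub>T\<^esub> br y (br z x) \<oplus>\<^bsub>T\<^esub> br z (br x y)" for x y z
  have add: "j (u \<oplus>\<^bsub>T\<^esub> v) y z = j u y z \<oplus>\<^bsub>T\<^esub> j v y z" "j y (u \<oplus>\<^bsub>T\<^esub> v) z = j y u z \<oplus>\<^bsub>T\<^esub> j y v z"
    "j y z (u \<oplus>\<^bsub>T\<^esub> v) = j y z u \<oplus>\<^bsub>T\<^esub> j y z v"
    if "u \<in> carrier T" "v \<in> carrier T" "y \<in> carrier T" "z \<in> carrier T" for u v y z
    using that by (simp_all add: j_def T.add.m_ac)
  have pure: "j (t a f) (t b g) (t c h) = \<zero>\<^bsub>T\<^esub>"
    if "a \<in> carrier A" "b \<in> carrier A" "c \<in> carrier A" "f \<in> carrier L" "g \<in> carrier L" "h \<in> carrier L"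
    for a b c f g h
  proof -
    have "j (t a f) (t b g) (t c h) =
      t (a \<otimes>\<^bsub>A\<^esub> (b \<otimes>\<^bsub>A\<^esub> c)) (lb f (lb g h) \<oplus>\<^bsub>L\<^esub> lb g (lb h f) \<oplus>\<^bsub>L\<^esub> lb h (lb f g))"
      using that by (simp add: j_def br_pure pure_simps)
    then show ?thesis using that by (simp add: L.br_jacobi)
  qed
  have pure2: "j (t a f) (t b g) w = \<zero>\<^bsub>T\<^esub>"
    if "w \<in> carrier T" "a \<in> carrier A" "b \<in> carrier A" "f \<in> carrier L" "g \<in> carrier L" for a b f g w
    using that(1) by (induction w rule: tensor_induct) (use that in \<open>simp_all add: add pure\<close>)
  have pure1: "j (t a f) v w = \<zero>\<^bsub>T\<^esub>"
    if "v \<in> carrier T" "w \<in> carrier T" "a \<in> carrier A" "f \<in> carrier L" for a f v w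
    using that(1) by (induction v rule: tensor_induct) (use that in \<open>simp_all add: add pure2\<close>)
  have "j x y z = \<zero>\<^bsub>T\<^esub>"
    using assms(1) by (induction x rule: tensor_induct) (use assms in \<open>simp_all add: add pure1\<close>)
  then show ?thesis by (simp add: j_def)
qed

sublocale B: lie_algebra_char3 K T br
  by unfold_locales (simp_all add: tbr_bilinear tbr_alternating tbr_jacobi L.char3)

section \<open>Existence of the 3-map\<close>

lemma cube_map_exists:
  obtains pm where "pm \<in> carrier T \<rightarrow> carrier T" "jacobson3 T br pm"
    "\<And>a f. \<lbrakk>a \<in> carrier A; f \<in> carrier L\<rbrakk> \<Longrightarrow> pm (t a f) = t (a \<otimes>\<^bsub>A\<^esub> a \<otimes>\<^bsub>A\<^esub> a) (lp f)"
proof -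
  let ?q = "\<lambda>a f. (t a f, t (a \<otimes>\<^bsub>A\<^esub> a \<otimes>\<^bsub>A\<^esub> a) (lp f))"
  have lp_add: "lp (f \<oplus>\<^bsub>L\<^esub> g) = lp f \<oplus>\<^bsub>L\<^esub> lp g \<oplus>\<^bsub>L\<^esub> lb f (lb f g) \<oplus>\<^bsub>L\<^esub> lb g (lb g f)"
    if "f \<in> carrier L" "g \<in> carrier L" for f g
    using L.pm_jacobson that by (simp add: jacobson3_def)
  obtain h where h: "h \<in> hom (add_monoid T) B.twisted"
    and h_pure: "\<And>a f. \<lbrakk>a \<in> carrier A; f \<in> carrier L\<rbrakk> \<Longrightarrow> h (t a f) = ?q a f"
  proof (rule tensor_lift [OF B.comm_group_twisted, of ?q])
    show "?q a f \<in> carrier B.twisted" if "a \<in> carrier A" "f \<in> carrier L" for a f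
      using that by (simp add: B.twisted_def L.pm_closed)
    \<comment> \<open>The twist vanishes because \<open>[f,f] = 0\<close>, and cubing in
      \<open>A\<close> is additive in characteristic 3.\<close>
    show "?q (a \<oplus>\<^bsub>A\<^esub> b) f = ?q a f \<otimes>\<^bsub>B.twisted\<^esub> ?q b f"
      if "a \<in> carrier A" "b \<in> carrier A" "f \<in> carrier L" for a b f
      using that
      by (simp add: B.twisted_def L.pm_closed B.jac_def br_pure L.br_alternating pure_simps)
    \<comment> \<open>The twist of \<open>a \<otimes> f\<close> and \<open>a \<otimes> g\<close> is
      \<open>a^3\<close> tensored with the correction term for \<open>lp\<close> in
      \<open>L\<close>.\<close>
    show "?q a (f \<oplus>\<^bsub>L\<^esub> g) = ?q a f \<otimes>\<^bsub>B.twisted\<^esub> ?q a g"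
      if "a \<in> carrier A" "f \<in> carrier L" "g \<in> carrier L" for a f g
      using that
      by (simp add: B.twisted_def L.pm_closed B.jac_def br_pure lp_add pure_simps)
    \<comment> \<open>Both second components are \<open>c^3\<close> times
      \<open>a^3 \<otimes> lp f\<close>.\<close>
    show "?q (c \<odot>\<^bsub>A\<^esub> a) f = ?q a (c \<odot>\<^bsub>L\<^esub> f)"
      if "c \<in> carrier K" "a \<in> carrier A" "f \<in> carrier L" for c a f
      using that by (simp add: L.pm_closed L.pm_smult numeral_3_eq_3 A.smult_assoc1 A.m_assoc
          flip: pure_smult)
  qed blast
  have closed: "h x \<in> carrier B.twisted" if "x \<in> carrier T" for x
    using h that by (auto simp: hom_def)
  have add: "h (x \<oplus>\<^bsub>T\<^esub> y) = h x \<otimes>\<^bsub>B.twisted\<^esub> h y" if "x \<in> carrier T" "y \<in> carrier T" for x y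
    using h that by (auto simp: hom_def)
  \<comment> \<open>The first component of the twisted group carries ordinary addition, so
    \<open>h\<close> is a section \<open>x \<mapsto> (x, s x)\<close>, and additivity of
    \<open>h\<close> becomes Jacobson's formula for \<open>s\<close>.\<close>
  have fst: "fst (h x) = x" if "x \<in> carrier T" for x
    using that by (induction x rule: tensor_induct)
      (simp_all add: h_pure add B.twisted_def case_prod_unfold)
  show thesis
  proof (rule that [of "\<lambda>x. snd (h x)"])
    show "(\<lambda>x. snd (h x)) \<in> carrier T \<rightarrow> carrier T"
      using closed by (auto simp: B.twisted_def mem_Times_iff)
    show "jacobson3 T br (\<lambda>x. snd (h x))"
      using closed by (auto simp: jacobson3_def add B.twisted_def case_prod_unfold fst B.jac_def
          mem_Times_iff T.a_assoc)
  qed (simp add: h_pure)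
qed

end

text \<open>The data of a homomorphism of restricted Lie algebras from \<open>L\<close> to the
  derivations of \<open>A\<close>. For a subalgebra of derivations the action is evaluation.\<close>

locale lie_action_tensor3 = lie_tensor3 +
  fixes act
  assumes act_closed [simp]: "\<lbrakk>f \<in> carrier L; a \<in> carrier A\<rbrakk> \<Longrightarrow> act f a \<in> carrier A"
    and act_add_left [simp]: "\<lbrakk>f \<in> carrier L; g \<in> carrier L; a \<in> carrier A\<rbrakk>
      \<Longrightarrow> act (f \<oplus>\<^bsub>L\<^esub> g) a = act f a \<oplus>\<^bsub>A\<^esub> act g a"
    and act_add_right [simp]: "\<lbrakk>f \<in> carrier L; a \<in> carrier A; b \<in> carrier A\<rbrakk>
      \<Longrightarrow> act f (a \<oplus>\<^bsub>A\<^esub> b) = act f a \<oplus>\<^bsub>A\<^esub> act f b"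
    and act_smult_left [simp]: "\<lbrakk>c \<in> carrier K; f \<in> carrier L; a \<in> carrier A\<rbrakk>
      \<Longrightarrow> act (c \<odot>\<^bsub>L\<^esub> f) a = c \<odot>\<^bsub>A\<^esub> act f a"
    and act_smult_right [simp]: "\<lbrakk>c \<in> carrier K; f \<in> carrier L; a \<in> carrier A\<rbrakk>
      \<Longrightarrow> act f (c \<odot>\<^bsub>A\<^esub> a) = c \<odot>\<^bsub>A\<^esub> act f a"
    and act_mult [simp]: "\<lbrakk>f \<in> carrier L; a \<in> carrier A; b \<in> carrier A\<rbrakk>
      \<Longrightarrow> act f (a \<otimes>\<^bsub>A\<^esub> b) = act f a \<otimes>\<^bsub>A\<^esub> b \<oplus>\<^bsub>A\<^esub> a \<otimes>\<^bsub>A\<^esub> act f b"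
    and act_bracket: "\<lbrakk>f \<in> carrier L; g \<in> carrier L; a \<in> carrier A\<rbrakk>
      \<Longrightarrow> act (lb f g) a = act f (act g a) \<ominus>\<^bsub>A\<^esub> act g (act f a)"
    and act_cube: "\<lbrakk>f \<in> carrier L; a \<in> carrier A\<rbrakk> \<Longrightarrow> act (lp f) a = act f (act f (act f a))"
begin

lemma product_exists:
  obtains pr where "bilinear_op K T pr"
    "\<And>a f b g. \<lbrakk>a \<in> carrier A; f \<in> carrier L; b \<in> carrier A; g \<in> carrier L\<rbrakk>
      \<Longrightarrow> pr (t a f) (t b g) = t (a \<otimes>\<^bsub>A\<^esub> act f b) g"
  by (rule tensor_bilinear_extension [of "\<lambda>a f b g. t (a \<otimes>\<^bsub>A\<^esub> act f b) g"])
    (auto simp: pure_add_left pure_add_right simp flip: pure_smult)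

end

section \<open>The post-Lie axioms for the product\<close>

locale tensor_post_lie = tensor_bracket K A L lb lp br + lie_action_tensor3 K A L lb lp act
  for K :: "('k, 'm) ring_scheme" (structure)
    and A :: "('k, 'a, 'n) module_scheme"
    and L :: "('k, 'b, 'l) module_scheme"
    and lb lp br act +
  fixes pr
  assumes tpr_bilinear: "bilinear_op K (tensor K A L) pr"
    and pr_pure: "\<lbrakk>a \<in> carrier A; f \<in> carrier L; b \<in> carrier A; g \<in> carrier L\<rbrakk>
      \<Longrightarrow> pr (pure_tensor K A L a f) (pure_tensor K A L b g) = pure_tensor K A L (a \<otimes>\<^bsub>A\<^esub> act f b) g"
begin

lemmas tpr_closed [simp] = bilinear_opD(1) [OF tpr_bilinear]
lemmas tpr_add_left [simp] = bilinear_opD(2) [OF tpr_bilinear]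
lemmas tpr_add_right [simp] = bilinear_opD(3) [OF tpr_bilinear]

text \<open>On elementary tensors this is the Leibniz rule for \<open>act f\<close> on
  \<open>bc\<close>, tensored with \<open>[g,h]\<close>; the rest is trilinearity.\<close>

lemma tpr_derivation:
  assumes "x \<in> carrier T" "y \<in> carrier T" "z \<in> carrier T"
  shows "pr x (br y z) = br (pr x y) z \<oplus>\<^bsub>T\<^esub> br y (pr x z)"
proof -
  have pure3: "pr (t a f) (br (t b g) (t c h)) = br (pr (t a f) (t b g)) (t c h) \<oplus>\<^bsub>T\<^esub> br (t b g) (pr (t a f) (t c h))"
    if "a \<in> carrier A" "b \<in> carrier A" "c \<in> carrier A" "f \<in> carrier L" "g \<in> carrier L" "h \<in> carrier L"
    for a b c f g h
    using that by (simp add: br_pure pr_pure pure_simps)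
  have pure2: "pr (t a f) (br (t b g) w) = br (pr (t a f) (t b g)) w \<oplus>\<^bsub>T\<^esub> br (t b g) (pr (t a f) w)"
    if "w \<in> carrier T" "a \<in> carrier A" "b \<in> carrier A" "f \<in> carrier L" "g \<in> carrier L" for a b f g w
    using that(1) by (induction w rule: tensor_induct) (use that in \<open>simp_all add: pure3 TT.normal3\<close>)
  have pure1: "pr (t a f) (br v w) = br (pr (t a f) v) w \<oplus>\<^bsub>T\<^esub> br v (pr (t a f) w)"
    if "v \<in> carrier T" "w \<in> carrier T" "a \<in> carrier A" "f \<in> carrier L" for a f v w
    using that(1) by (induction v rule: tensor_induct) (use that in \<open>simp_all add: pure2 TT.normal3\<close>)
  show ?thesis
    using assms(1) by (induction x rule: tensor_induct) (use assms in \<open>simp_all add: pure1 TT.normal3\<close>)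
qed

text \<open>By the Leibniz rule the associator of \<open>a \<otimes> f\<close>,
  \<open>b \<otimes> g\<close>, \<open>c \<otimes> h\<close> is
  \<open>a b f(g(c)) \<otimes> h\<close>; antisymmetrizing in the first two arguments gives
  \<open>[f,g]\<close>.\<close>

lemma tpr_bracket:
  assumes "x \<in> carrier T" "y \<in> carrier T" "z \<in> carrier T"
  shows "pr (br x y) z = associator T pr x y z \<ominus>\<^bsub>T\<^esub> associator T pr y x z"
proof -
  let ?P = "\<lambda>x y z. pr (br x y) z = associator T pr x y z \<ominus>\<^bsub>T\<^esub> associator T pr y x z"
  have pure3: "?P (t a f) (t b g) (t c h)"
    if "a \<in> carrier A" "b \<in> carrier A" "c \<in> carrier A" "f \<in> carrier L" "g \<in> carrier L" "h \<in> carrier L"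
    for a b c f g h
    using that by (simp add: associator_def br_pure pr_pure act_bracket AA.minus3 pure_simps)
  have pure2: "?P (t a f) (t b g) w"
    if "w \<in> carrier T" "a \<in> carrier A" "b \<in> carrier A" "f \<in> carrier L" "g \<in> carrier L" for a b f g w
    using that(1) by (induction w rule: tensor_induct)
      (use that in \<open>simp_all add: pure3, simp_all add: associator_def TT.normal3\<close>)
  have pure1: "?P (t a f) v w"
    if "v \<in> carrier T" "w \<in> carrier T" "a \<in> carrier A" "f \<in> carrier L" for a f v w
    using that(1) by (induction v rule: tensor_induct)
      (use that in \<open>simp_all add: pure2, simp_all add: associator_def TT.normal3\<close>)
  show ?thesis
    using assms(1) by (induction x rule: tensor_induct)
      (use assms in \<open>simp_all add: pure1, simp_all add: associator_def TT.normal3\<close>)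
qed

sublocale P: post_lie_algebra_char3 K T br pr
  by unfold_locales (simp_all add: tpr_bilinear tpr_derivation tpr_bracket)

end

section \<open>Compatibility of the 3-map with bracket and product\<close>

locale tensor_restricted_post_lie = tensor_post_lie K A L lb lp br act pr
  for K :: "('k, 'm) ring_scheme" (structure)
    and A :: "('k, 'a, 'n) module_scheme"
    and L :: "('k, 'b, 'l) module_scheme"
    and lb lp br act pr +
  fixes pm
  assumes tpm_closed: "pm \<in> carrier (tensor K A L) \<rightarrow> carrier (tensor K A L)"
    and tpm_jacobson: "jacobson3 (tensor K A L) br pm"
    and pm_pure: "\<lbrakk>a \<in> carrier A; f \<in> carrier L\<rbrakk>
      \<Longrightarrow> pm (pure_tensor K A L a f) = pure_tensor K A L (a \<otimes>\<^bsub>A\<^esub> a \<otimes>\<^bsub>A\<^esub> a) (lp f)"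
begin

lemma pm_closed [simp]: "x \<in> carrier T \<Longrightarrow> pm x \<in> carrier T"
  using tpm_closed by blast

lemma pm_add:
  "\<lbrakk>x \<in> carrier T; y \<in> carrier T\<rbrakk> \<Longrightarrow> pm (x \<oplus>\<^bsub>T\<^esub> y) = pm x \<oplus>\<^bsub>T\<^esub> pm y \<oplus>\<^bsub>T\<^esub> B.jac x y"
  using tpm_jacobson by (simp add: jacobson3_def B.jac_def T.a_assoc)

lemma lp_closed [simp]: "f \<in> carrier L \<Longrightarrow> lp f \<in> carrier L"
  by (rule L.pm_closed)

lemma tpm_smult:
  assumes "c \<in> carrier K" "x \<in> carrier T"
  shows "pm (c \<odot>\<^bsub>T\<^esub> x) = (c [^] (3::nat)) \<odot>\<^bsub>T\<^esub> pm x"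
  using assms(2)
  by (induction x rule: tensor_induct)
    (use assms in \<open>simp_all add: pm_pure pm_add T.smult_r_distr B.jac_smult numeral_3_eq_3 A.smult_assoc1 A.m_assoc\<close>)

lemma tpm_ad:
  assumes "x \<in> carrier T" "y \<in> carrier T"
  shows "br (pm x) y = br x (br x (br x y))"
  using assms(1)
proof (induction x rule: tensor_induct)
  case (pure a f)
  show ?case using assms(2)
    by (induction y rule: tensor_induct)
      (use pure in \<open>simp_all add: pm_pure br_pure L.pm_ad mult_ac\<close>)
next
  case (add u v)
  then show ?case
    using assms(2) B.ad_add_cube [of u v y] by (simp add: pm_add del: B.br_add_right)
qed

text \<open>At an elementary tensor \<open>y = b \<otimes> g\<close> both sides vanish:
  \<open>f(b^3) = 3 b^2 f(b) = 0\<close> and \<open>[g,g] = 0\<close>. Sums in \<open>y\<close> are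
  handled by \<open>derivation_jac\<close>, as the product with \<open>x\<close> is a derivation of
  the bracket.\<close>

lemma tpr_pm:
  assumes "x \<in> carrier T" "y \<in> carrier T"
  shows "pr x (pm y) = br y (br y (pr x y))"
  using assms(2)
proof (induction y rule: tensor_induct)
  case (pure b g)
  show ?case using assms(1)
    by (induction x rule: tensor_induct)
      (use pure in \<open>simp_all add: pm_pure br_pure pr_pure L.br_alternating pure_simps AA.normal3\<close>)
next
  case (add u v)
  then show ?case
    using assms(1) B.derivation_jac [of u v "pr x u" "pr x v"]
    by (simp add: pm_add B.jac_def tpr_derivation del: B.br_add_left B.br_add_right tbr_add_left tbr_add_right)
qed

text \<open>For \<open>x = a \<otimes> f\<close> and \<open>y = b \<otimes> g\<close>, expansion
  leaves \<open>a^3 f(f(f(b)))\<close>: the terms \<open>a f(a)^2 f(b)\<close>,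
  \<open>a^2 f(a) f(f(b))\<close> and \<open>a^2 f(f(a)) f(b)\<close> occur 6, 6 and 3 times. Sums
  in \<open>x\<close> are handled by \<open>cube_terms_add\<close>.\<close>

lemma tpm_pr:
  assumes "x \<in> carrier T" "y \<in> carrier T"
  shows "pr (pm x) y = P.cube_terms x x x y"
  using assms(1)
proof (induction x rule: tensor_induct)
  case (pure a f)
  show ?case using assms(2)
  proof (induction y rule: tensor_induct)
    case (pure b g)
    then show ?case using \<open>a \<in> _\<close> \<open>f \<in> _\<close>
      by (simp add: P.cube_terms_def pm_pure pr_pure act_cube pure_simps)
  qed (use pure in \<open>simp_all add: P.cube_terms_add_right\<close>)
next
  case (add u v)
  then show ?case using assms(2) by (simp add: pm_add P.cube_terms_add)
qed

lemma trivially_restricted_post_lie_algebra3: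
  "trivially_restricted_post_lie_algebra3 K T br pm pr"
  by unfold_locales
    (simp_all add: L.char3 tpm_smult tpm_ad tpm_jacobson tpr_pm tpm_pr, simp add: P.cube_terms_def)

end

section \<open>Lie algebras of derivations\<close>

context module
begin

abbreviation "E \<equiv> endo_algebra R M"

lemma endo_closed: "\<lbrakk>f \<in> carrier E; x \<in> carrier M\<rbrakk> \<Longrightarrow> f x \<in> carrier M"
  by (auto simp: endo_algebra_def)

lemma endo_add: "\<lbrakk>f \<in> carrier E; x \<in> carrier M; y \<in> carrier M\<rbrakk> \<Longrightarrow> f (x \<oplus>\<^bsub>M\<^esub> y) = f x \<oplus>\<^bsub>M\<^esub> f y"
  by (auto simp: endo_algebra_def)

lemma endo_smult: "\<lbrakk>f \<in> carrier E; c \<in> carrier R; x \<in> carrier M\<rbrakk> \<Longrightarrow> f (c \<odot>\<^bsub>M\<^esub> x) = c \<odot>\<^bsub>M\<^esub> f x"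
  by (auto simp: endo_algebra_def)

lemma endo_eqI:
  "\<lbrakk>f \<in> carrier E; g \<in> carrier E; \<And>x. x \<in> carrier M \<Longrightarrow> f x = g x\<rbrakk> \<Longrightarrow> f = g"
  by (auto simp: endo_algebra_def intro: PiE_ext)

lemma endo_apply [simp]:
  assumes "x \<in> carrier M"
  shows "(f \<oplus>\<^bsub>E\<^esub> g) x = f x \<oplus>\<^bsub>M\<^esub> g x" "(c \<odot>\<^bsub>E\<^esub> f) x = c \<odot>\<^bsub>M\<^esub> f x"
    "(f \<otimes>\<^bsub>E\<^esub> g) x = f (g x)" "\<zero>\<^bsub>E\<^esub> x = \<zero>\<^bsub>M\<^esub>"
  using assms by (simp_all add: endo_algebra_def compose_def)

lemma endo_mult_closed: "\<lbrakk>f \<in> carrier E; g \<in> carrier E\<rbrakk> \<Longrightarrow> f \<otimes>\<^bsub>E\<^esub> g \<in> carrier E"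
  by (auto simp: endo_algebra_def compose_def PiE_iff)

lemma endo_cube: "\<lbrakk>f \<in> carrier E; x \<in> carrier M\<rbrakk> \<Longrightarrow> (f [^]\<^bsub>E\<^esub> (3::nat)) x = f (f (f x))"
  by (simp add: numeral_3_eq_3 nat_pow_def) (simp add: endo_algebra_def compose_def PiE_iff)

lemma module_endo_algebra: "module R E"
proof (rule moduleI)
  show "abelian_group E"
  proof (rule abelian_groupI)
    fix f assume f: "f \<in> carrier E"
    let ?n = "\<lambda>x\<in>carrier M. \<ominus>\<^bsub>M\<^esub> f x"
    have n: "?n \<in> carrier E"
      using f by (auto simp: endo_algebra_def PiE_iff M.minus_add smult_r_minus)
    then have "?n \<oplus>\<^bsub>E\<^esub> f = \<zero>\<^bsub>E\<^esub>"
      using f by (auto simp: endo_algebra_def PiE_iff fun_eq_iff M.l_neg)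
    with n show "\<exists>g\<in>carrier E. g \<oplus>\<^bsub>E\<^esub> f = \<zero>\<^bsub>E\<^esub>" by blast
  qed (auto simp: endo_algebra_def PiE_iff fun_eq_iff M.add.m_ac smult_r_distr extensional_def)
qed (auto simp: is_cring endo_algebra_def PiE_iff smult_r_distr smult_l_distr fun_eq_iff
    m_comm extensional_def simp flip: smult_assoc1)

end

section \<open>Restricted Lie algebras of derivations\<close>

locale derivation_subalgebra3 = comm_assoc_algebra K A
  for K :: "('k, 'm) ring_scheme" (structure) and A :: "('k, 'a, 'n) module_scheme" (structure) +
  fixes D :: "('a \<Rightarrow> 'a) set"
  assumes char3: "ring_char K = 3"
    and subalgebra: "restricted_lie_subalgebra3 D K A"
begin

abbreviation "L \<equiv> sub_endo K A D"
abbreviation "lb \<equiv> commutator (endo_algebra K A)"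
abbreviation "lp \<equiv> \<lambda>f. f [^]\<^bsub>endo_algebra K A\<^esub> (3::nat)"

sublocale A3: abelian_group3 A by (rule abelian_group3I [OF char3])

lemma D_carrier: "f \<in> D \<Longrightarrow> f \<in> carrier E"
  using subalgebra by (auto simp: restricted_lie_subalgebra3_def derivations_def)

lemma D_closed [simp]: "f \<in> D \<Longrightarrow> x \<in> carrier A \<Longrightarrow> f x \<in> carrier A"
  by (simp add: D_carrier endo_closed)

lemma D_add [simp]:
  "\<lbrakk>f \<in> D; x \<in> carrier A; y \<in> carrier A\<rbrakk> \<Longrightarrow> f (x \<oplus>\<^bsub>A\<^esub> y) = f x \<oplus>\<^bsub>A\<^esub> f y"
  by (simp add: D_carrier endo_add)

lemma D_smult [simp]:
  "\<lbrakk>f \<in> D; c \<in> carrier K; x \<in> carrier A\<rbrakk> \<Longrightarrow> f (c \<odot>\<^bsub>A\<^esub> x) = c \<odot>\<^bsub>A\<^esub> f x"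
  by (simp add: D_carrier endo_smult)

lemma D_mult:
  "\<lbrakk>f \<in> D; x \<in> carrier A; y \<in> carrier A\<rbrakk>
    \<Longrightarrow> f (x \<otimes>\<^bsub>A\<^esub> y) = f x \<otimes>\<^bsub>A\<^esub> y \<oplus>\<^bsub>A\<^esub> x \<otimes>\<^bsub>A\<^esub> f y"
  using subalgebra by (auto simp: restricted_lie_subalgebra3_def derivations_def)

lemma submodule_D: "submodule D K E"
  and lb_closed [simp]: "\<lbrakk>f \<in> D; g \<in> D\<rbrakk> \<Longrightarrow> lb f g \<in> D"
  and lp_closed [simp]: "f \<in> D \<Longrightarrow> lp f \<in> D"
  using subalgebra by (auto simp: restricted_lie_subalgebra3_def)

lemma L_simps [simp]:
  "carrier L = D" "(\<oplus>\<^bsub>L\<^esub>) = (\<oplus>\<^bsub>E\<^esub>)" "(\<odot>\<^bsub>L\<^esub>) = (\<odot>\<^bsub>E\<^esub>)" "\<zero>\<^bsub>L\<^esub> = \<zero>\<^bsub>E\<^esub>"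
  by (simp_all add: sub_endo_def)

lemma D_eqI: "\<lbrakk>f \<in> D; g \<in> D; \<And>x. x \<in> carrier A \<Longrightarrow> f x = g x\<rbrakk> \<Longrightarrow> f = g"
  by (rule endo_eqI) (simp_all add: D_carrier)

lemma lp_apply [simp]: "\<lbrakk>f \<in> D; x \<in> carrier A\<rbrakk> \<Longrightarrow> lp f x = f (f (f x))"
  by (simp add: D_carrier endo_cube)

text \<open>Negation in \<open>E\<close> is an abstract additive inverse, so its pointwise value
  comes from uniqueness of inverses in \<open>A\<close>. Doubling replaces the sign to suit
  \<open>normal3\<close>.\<close>

lemma lb_apply [simp]:
  assumes "f \<in> D" "g \<in> D" "x \<in> carrier A"
  shows "lb f g x = f (g x) \<oplus>\<^bsub>A\<^esub> (g (f x) \<oplus>\<^bsub>A\<^esub> g (f x))"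
proof -
  interpret E: module K E by (rule module_endo_algebra)
  have c: "f \<otimes>\<^bsub>E\<^esub> g \<in> carrier E" "g \<otimes>\<^bsub>E\<^esub> f \<in> carrier E"
    using assms by (simp_all add: D_carrier endo_mult_closed)
  have "(\<ominus>\<^bsub>E\<^esub> h) x \<oplus>\<^bsub>A\<^esub> h x = \<zero>\<^bsub>A\<^esub>" if "h \<in> carrier E" for h
    using E.l_neg [OF that] assms(3) endo_apply(1) [of x "\<ominus>\<^bsub>E\<^esub> h" h] by simp
  then have "(\<ominus>\<^bsub>E\<^esub> h) x = h x \<oplus>\<^bsub>A\<^esub> h x" if "h \<in> carrier E" for h
    using that assms(3) by (metis A3.minus3 M.minus_equality endo_closed E.a_inv_closed)
  then show ?thesis
    using assms c by (simp add: commutator_def a_minus_def)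
qed

lemma module_L: "module K L"
  unfolding sub_endo_def by (rule submodule.submodule_is_module [OF submodule_D module_endo_algebra])

sublocale L: module K L by (rule module_L)

lemma L_closed [simp]:
  "\<lbrakk>f \<in> D; g \<in> D\<rbrakk> \<Longrightarrow> f \<oplus>\<^bsub>E\<^esub> g \<in> D" "\<lbrakk>c \<in> carrier K; f \<in> D\<rbrakk> \<Longrightarrow> c \<odot>\<^bsub>E\<^esub> f \<in> D" "\<zero>\<^bsub>E\<^esub> \<in> D"
  using L.a_closed [of f g] L.smult_closed [of c f] L.zero_closed by simp_all

text \<open>The identities are those of commutators and cubes in an associative algebra of
  characteristic 3; each is checked by evaluation at a point of \<open>A\<close>.\<close>

lemma restricted_lie_algebra3_L: "restricted_lie_algebra3 K L lb lp"
proof unfold_locales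
  show "bilinear_op K L lb"
    by (auto simp: bilinear_op_def smult_r_distr A3.normal3 intro!: D_eqI)
  show "lb f f = \<zero>\<^bsub>L\<^esub>" if "f \<in> carrier L" for f
    using that by (auto simp: A3.normal3 intro!: D_eqI)
  show "lb f (lb g h) \<oplus>\<^bsub>L\<^esub> lb g (lb h f) \<oplus>\<^bsub>L\<^esub> lb h (lb f g) = \<zero>\<^bsub>L\<^esub>"
    if "f \<in> carrier L" "g \<in> carrier L" "h \<in> carrier L" for f g h
    using that by (auto simp: A3.normal3 intro!: D_eqI)
  show "lp f \<in> carrier L" if "f \<in> carrier L" for f using that by simp
  show "lp (c \<odot>\<^bsub>L\<^esub> f) = (c [^] (3::nat)) \<odot>\<^bsub>L\<^esub> lp f" if "c \<in> carrier K" "f \<in> carrier L" for c f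
  proof -
    have "c [^] (3::nat) = c \<otimes> (c \<otimes> c)"
      using that(1) by (simp add: numeral_3_eq_3 m_assoc)
    with that show ?thesis by (auto simp: smult_assoc1 intro!: D_eqI)
  qed
  show "lb (lp f) g = lb f (lb f (lb f g))" if "f \<in> carrier L" "g \<in> carrier L" for f g
    using that by (auto simp: A3.normal3 intro!: D_eqI)
  show "jacobson3 L lb lp"
    by (auto simp: jacobson3_def A3.normal3 intro!: D_eqI)
qed (rule char3)

sublocale X: lie_action_tensor3 K A L lb lp "\<lambda>f. f"
proof (intro lie_action_tensor3.intro lie_tensor3.intro)
  show "lie_action_tensor3_axioms K A L lb lp (\<lambda>f. f)"
    by unfold_locales (simp_all add: D_mult A3.normal3)
qed (simp_all add: restricted_lie_algebra3_L comm_assoc_algebra_axioms)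

text \<open>Makes the results of the locale available for any triple of operations, both for
  uniqueness and for the algebraic conclusion.\<close>

lemma tensor_operations_iff:
  "tensor_operations K A D br pm pr \<longleftrightarrow>
    br \<in> carrier X.T \<rightarrow>\<^sub>E carrier X.T \<rightarrow>\<^sub>E carrier X.T \<and> pm \<in> carrier X.T \<rightarrow>\<^sub>E carrier X.T \<and>
    pr \<in> carrier X.T \<rightarrow>\<^sub>E carrier X.T \<rightarrow>\<^sub>E carrier X.T \<and>
    tensor_restricted_post_lie K A L lb lp br (\<lambda>f. f) pr pm"
  unfolding tensor_operations_def Let_def tensor_restricted_post_lie_def tensor_post_lie_def
    tensor_bracket_def tensor_restricted_post_lie_axioms_def tensor_post_lie_axioms_def
    tensor_bracket_axioms_def
  using X.lie_action_tensor3_axioms X.lie_tensor3_axioms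
  by auto

section \<open>Existence and uniqueness of the operations\<close>

lemma tensor_operations_exist: "\<exists>br pm pr. tensor_operations K A D br pm pr"
proof -
  obtain br where "bilinear_op K X.T br"
    "\<And>a f b g. \<lbrakk>a \<in> carrier A; f \<in> carrier L; b \<in> carrier A; g \<in> carrier L\<rbrakk>
      \<Longrightarrow> br (X.t a f) (X.t b g) = X.t (a \<otimes>\<^bsub>A\<^esub> b) (lb f g)"
    by (rule X.bracket_exists) blast
  then interpret B: tensor_bracket K A L lb lp br
    by unfold_locales
  obtain pm where pm: "pm \<in> carrier X.T \<rightarrow> carrier X.T" "jacobson3 X.T br pm"
    "\<And>a f. \<lbrakk>a \<in> carrier A; f \<in> carrier L\<rbrakk> \<Longrightarrow> pm (X.t a f) = X.t (a \<otimes>\<^bsub>A\<^esub> a \<otimes>\<^bsub>A\<^esub> a) (lp f)"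
    by (rule B.cube_map_exists) blast
  obtain pr where pr: "bilinear_op K X.T pr"
    "\<And>a f b g. \<lbrakk>a \<in> carrier A; f \<in> carrier L; b \<in> carrier A; g \<in> carrier L\<rbrakk>
      \<Longrightarrow> pr (X.t a f) (X.t b g) = X.t (a \<otimes>\<^bsub>A\<^esub> f b) g"
    by (rule X.product_exists) blast
  \<comment> \<open>Both arguments are restricted, as the curried extensional function space
    demands.\<close>
  let ?r = "\<lambda>b. \<lambda>x\<in>carrier X.T. \<lambda>y\<in>carrier X.T. b x y"
  have "bilinear_op K X.T (?r b)" if "bilinear_op K X.T b" for b
    using that by (simp add: bilinear_op_def)
  then have "tensor_operations K A D (?r br) (restrict pm (carrier X.T)) (?r pr)"
    using pm pr B.tbr_bilinear B.br_pure bilinear_opD(1) [OF pr(1)]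
    by (auto simp: tensor_operations_def Let_def jacobson3_def)
  then show ?thesis by blast
qed

text \<open>The brackets are identified before the 3-maps, since Jacobson's formula determines a
  3-map only relative to its bracket.\<close>

lemma tensor_operations_unique:
  assumes "tensor_operations K A D br pm pr" "tensor_operations K A D br' pm' pr'"
  shows "br = br' \<and> pm = pm' \<and> pr = pr'"
proof -
  interpret S: tensor_restricted_post_lie K A L lb lp br "\<lambda>f. f" pr pm
    using assms(1) by (simp add: tensor_operations_iff)
  interpret S': tensor_restricted_post_lie K A L lb lp br' "\<lambda>f. f" pr' pm'
    using assms(2) by (simp add: tensor_operations_iff)
  have ext: "b = b'" if "b \<in> carrier X.T \<rightarrow>\<^sub>E carrier X.T \<rightarrow>\<^sub>E carrier X.T"
    "b' \<in> carrier X.T \<rightarrow>\<^sub>E carrier X.T \<rightarrow>\<^sub>E carrier X.T"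
    "\<And>x y. \<lbrakk>x \<in> carrier X.T; y \<in> carrier X.T\<rbrakk> \<Longrightarrow> b x y = b' x y" for b b'
  proof (rule PiE_ext [OF that(1,2)])
    fix x assume x: "x \<in> carrier X.T"
    then show "b x = b' x"
      using PiE_ext [OF PiE_mem [OF that(1) x] PiE_mem [OF that(2) x]] that(3) by blast
  qed
  have br: "br = br'"
    by (rule ext) (use assms X.bilinear_op_unique [OF S.tbr_bilinear S'.tbr_bilinear] in
      \<open>simp_all add: tensor_operations_iff S.br_pure S'.br_pure\<close>)
  have pr: "pr = pr'"
    by (rule ext) (use assms X.bilinear_op_unique [OF S.tpr_bilinear S'.tpr_bilinear] in
      \<open>simp_all add: tensor_operations_iff S.pr_pure S'.pr_pure\<close>)
  have "pm x = pm' x" if "x \<in> carrier X.T" for x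
    using X.cube_map_unique [OF S.tpm_jacobson] S'.tpm_jacobson that
    by (simp add: br S.pm_pure S'.pm_pure)
  then have "pm = pm'"
    using assms by (intro PiE_ext [of pm "carrier X.T" "\<lambda>_. carrier X.T" pm'])
      (simp_all add: tensor_operations_iff)
  with br pr show ?thesis by simp
qed

end

theorem proposition3p3p12:
  fixes K :: "('k, 'm) ring_scheme"
    and A :: "('k, 'a, 'n) module_scheme"
    and D :: "('a \<Rightarrow> 'a) set"
  assumes "field K"
    and "ring_char K = 3"
    and "comm_assoc_algebra K A"
    and "restricted_lie_subalgebra3 D K A"
  shows "(\<exists>!(br, pm, pr). tensor_operations K A D br pm pr) \<and>
    (\<forall>br pm pr. tensor_operations K A D br pm pr \<longrightarrow>
      trivially_restricted_post_lie_algebra3 K (tensor K A (sub_endo K A D)) br pm pr)"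
proof -
  interpret derivation_subalgebra3 K A D
    using assms by (simp add: derivation_subalgebra3_def derivation_subalgebra3_axioms_def)
  have "\<exists>!(br, pm, pr). tensor_operations K A D br pm pr"
    using tensor_operations_exist tensor_operations_unique by (auto 0 4 intro!: ex_ex1I)
  moreover have "trivially_restricted_post_lie_algebra3 K (tensor K A (sub_endo K A D)) br pm pr"
    if "tensor_operations K A D br pm pr" for br pm pr
    using that tensor_restricted_post_lie.trivially_restricted_post_lie_algebra3
    by (auto simp: tensor_operations_iff)
  ultimately show ?thesis by blast
qed

end
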